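(* Let $\mathbf u'(t)=\mathbf f(\mathbf u(t))$ be an initial-value problem in $\mathbb R^d$ that conserves the functional $\eta\in\mathcal C^2$, i.e. $\eta'(\mathbf u)\mathbf f(\mathbf u)=0$. Let $\mathbf u^{n+1}$ be the result of one step of size $\Delta t$ from $\mathbf u^n$ with a baseline one-step method of order $p\ge 2$, and let $\eta_{\mathrm{old}}=\eta(\mathbf u^n)$. Let $V$ be an open neighborhood of $1$ and let $\mathbf u^{n+\gamma}$, $\gamma\in V$, satisfy $$\mathbf u^{n+\gamma}=\mathbf u^{n+1}+(\gamma-1)\Delta t\,\mathbf d^n_\gamma(\Delta t)+\mathcal O(\Delta t^{p+1}),$$ where $\gamma\mapsto \mathbf d^n_\gamma(\Delta t)$ is a $\mathcal C^1$ map on $V$ and $\lVert \mathbf d^n_1(\Delta t)\rVert_2\neq 0$ for $\Delta t$ small enough. Let $\widetilde\gamma$ be the continuous function, defined in a neighborhood of $0$ with $\widetilde\gamma(0)=1$, that satisfies $\lambda=(\widetilde\gamma(\lambda)-1)\,\Delta t\,\lVert \mathbf d^n_{\widetilde\gamma(\lambda)}(\Delta t)\rVert_2$. Suppose that $$\eta'(\mathbf u^{n+1})\cdot\frac{\mathbf d^n_{\widetilde \gamma(\Delta t\,\mu)}(\Delta t)}{\lVert \mathbf d^n_{\widetilde \gamma(\Delta t\,\mu)}(\Delta t)\rVert_2}= c(\mathbf u^n,\mu)\,\Delta t +\mathcal O(\Delta t^2)$$ for $|\mu|$ small enough, and $$\lim_{\mu\to 0}c(\mathbf u^n,\mu)=:\widetilde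 c(\mathbf u^n)\neq 0.$$ Then, for all sufficiently small $\Delta t>0$, the equation $$\eta(\mathbf u^{n+\gamma})-\eta_{\mathrm{old}}=0$$ possesses a positive solution $\gamma$. Furthermore, if $\lVert\mathbf d_\gamma^n(\Delta t)\rVert_2=\mathcal O(\Delta t^q)$, then there exists a unique positive solution satisfying $\gamma=1+\mathcal O(\Delta t^{p-1-q})$.
   Context: A one-step method has order $p$ if $\mathbf u^{n+1}=\mathbf u(t_n+\Delta t)+\mathcal O(\Delta t^{p+1})$ as $\Delta t\to0$, where $\mathbf u(t)$ is the exact local solution with $\mathbf u(t_n)=\mathbf u^n$. All $\mathcal O$-terms refer to $\Delta t\to 0$. The quantities $\mathbf u^{n+1}$, $\mathbf u^{n+\gamma}$, $\mathbf d^n_\gamma$ and $\widetilde\gamma$ all depend on $\Delta t$ (and on $\mathbf u^n$). $\mathbf u^{n+\gamma}$ is a one-parameter family of numerical approximations ("relaxation update") with $\gamma\approx1$, and $\mathbf d^n_\gamma(\Delta t)\in\mathbb R^d$ is a vector depending on the method. The function $\widetilde\gamma$ comes from the implicit function theorem applied at $(\lambda,\gamma)=(0,1)$ to $h(\lambda,\gamma)=\lambda-(\gamma-1)\Delta t\lVert\mathbf d^n_\gamma(\Delta t)\rVert_2$; it exists for $\Delta t>0$ small enough.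
   Formalization: Added: u^{n+γ} continuous in γ; O-terms uniform in γ, μ; γ̃>0 on a domain much larger than Δt^p; ‖d‖=O(Δt^q) read as exact order, uniform in γ; uniqueness only if d, update remainder and slope are Lipschitz in γ with constants O(Δt^q), O(Δt^{p+1}), O(Δt). *)

theory Defs
  imports "HOL-Analysis.Analysis" "HOL-Library.Landau_Symbols"
begin

text \<open>Throughout, \<open>h\<close> is the step size and asymptotic statements are for \<open>h \<rightarrow> 0+\<close>,
  i.e. along the filter \<open>at_right 0\<close>.\<close>

definition local_solution ::
    "('a::real_normed_vector \<Rightarrow> 'a) \<Rightarrow> real \<Rightarrow> 'a \<Rightarrow> (real \<Rightarrow> 'a) \<Rightarrow> bool" where
  "local_solution f t0 u0 u \<longleftrightarrow> u t0 = u0 \<and>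
     (\<exists>T>0. \<forall>t\<in>{t0..<t0 + T}. (u has_vector_derivative f (u t)) (at t within {t0..<t0 + T}))"

text \<open>A one-step method is the map \<open>\<Phi>\<close> taking the step size and the current state to the new state.
  The order condition is required at the given state only.\<close>

definition has_order_at ::
    "('a::real_normed_vector \<Rightarrow> 'a) \<Rightarrow> (real \<Rightarrow> 'a \<Rightarrow> 'a) \<Rightarrow> 'a \<Rightarrow> nat \<Rightarrow> bool" where
  "has_order_at f \<Phi> u0 p \<longleftrightarrow>
     (\<forall>t0 u. local_solution f t0 u0 u \<longrightarrow>
        (\<lambda>h. norm (\<Phi> h u0 - u (t0 + h))) \<in> O[at_right 0](\<lambda>h. h ^ (p + 1)))"

definition C2_functional :: "('a::real_normed_vector \<Rightarrow> real) \<Rightarrow> bool" where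
  "C2_functional \<eta> \<longleftrightarrow>
     (\<exists>(D :: 'a \<Rightarrow> 'a \<Rightarrow>\<^sub>L real) (D2 :: 'a \<Rightarrow> 'a \<Rightarrow>\<^sub>L ('a \<Rightarrow>\<^sub>L real)).
        (\<forall>x. (\<eta> has_derivative blinfun_apply (D x)) (at x)) \<and>
        (\<forall>x. (D has_derivative blinfun_apply (D2 x)) (at x)) \<and>
        continuous_on UNIV D2)"

definition conserves :: "('a::real_normed_vector \<Rightarrow> 'a) \<Rightarrow> ('a \<Rightarrow> real) \<Rightarrow> bool" where
  "conserves f \<eta> \<longleftrightarrow> (\<forall>x. frechet_derivative \<eta> (at x) (f x) = 0)"

definition normalized_slope :: "('a::real_normed_vector \<Rightarrow> real) \<Rightarrow> 'a \<Rightarrow> 'a \<Rightarrow> real" where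
  "normalized_slope \<eta> x v = frechet_derivative \<eta> (at x) (v /\<^sub>R norm v)"

text \<open>For a fixed step size \<open>h\<close> and direction field \<open>d\<close>, the function \<open>g\<close> is a continuous solution,
  on the neighbourhood \<open>{- r<..<r}\<close> of 0, of the equation
  \<open>l - (g l - 1) * h * norm (d (g l)) = 0\<close> with \<open>g 0 = 1\<close>, with values in the parameter set \<open>V\<close>.
  Since \<open>g 0 = 1\<close>, the branch is positive near 0; \<open>r\<close> is taken so small that it stays positive
  throughout.\<close>

definition implicit_branch ::
    "real set \<Rightarrow> (real \<Rightarrow> 'a::real_normed_vector) \<Rightarrow> real \<Rightarrow> real \<Rightarrow> (real \<Rightarrow> real) \<Rightarrow> bool" where
  "implicit_branch V d h r g \<longleftrightarrow>
     0 < r \<and> continuous_on {- r<..<r} g \<and> g 0 = 1 \<and>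
     (\<forall>l\<in>{- r<..<r}. g l \<in> V \<and> 0 < g l \<and> l = (g l - 1) * h * norm (d (g l)))"

text \<open>The family \<open>F h\<close> of functions on \<open>S\<close> is Lipschitz in its argument, with a constant of size
  \<open>O(\<phi> h)\<close>.\<close>

definition lipschitz_bigo ::
    "'a::metric_space set \<Rightarrow> (real \<Rightarrow> 'a \<Rightarrow> 'b::metric_space) \<Rightarrow> (real \<Rightarrow> real) \<Rightarrow> bool" where
  "lipschitz_bigo S F \<phi> \<longleftrightarrow> (\<exists>C. \<forall>\<^sub>F h in at_right 0. (C * \<phi> h)-lipschitz_on S (F h))"

definition positive_root ::
    "real set \<Rightarrow> ('a \<Rightarrow> real) \<Rightarrow> (real \<Rightarrow> 'a) \<Rightarrow> real \<Rightarrow> real \<Rightarrow> bool" where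
  "positive_root V \<eta> w \<eta>old \<gamma> \<longleftrightarrow> \<gamma> \<in> V \<and> 0 < \<gamma> \<and> \<eta> (w \<gamma>) - \<eta>old = 0"

text \<open>A choice of positive roots for all small step sizes with
  \<open>\<gamma> = 1 + O(h powr s)\<close>; here \<open>w h\<close> is the relaxed family for the step size \<open>h\<close>.\<close>

definition root_with_rate ::
    "real set \<Rightarrow> ('a \<Rightarrow> real) \<Rightarrow> (real \<Rightarrow> real \<Rightarrow> 'a) \<Rightarrow> real \<Rightarrow> real \<Rightarrow> (real \<Rightarrow> real) \<Rightarrow> bool" where
  "root_with_rate V \<eta> w \<eta>old s \<gamma> \<longleftrightarrow>
     (\<forall>\<^sub>F h in at_right 0. positive_root V \<eta> (w h) \<eta>old (\<gamma> h)) \<and>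
     (\<lambda>h. \<gamma> h - 1) \<in> O[at_right 0](\<lambda>h. h powr s)"

end

theory Submission
  imports Defs
begin

text \<open>The relaxed states are moved away from the baseline state along \<open>d\<close>, and \<open>l = (\<gamma> - 1) * h * norm d\<close>
measures the signed length of this displacement; the branch \<open>gt\<close> makes \<open>l\<close> itself the parameter. Since the
exact flow conserves \<open>\<eta>\<close> and the method has order \<open>p\<close>, the baseline step misses the value \<open>\<eta> un\<close> by
only \<open>O(h ^ (p + 1))\<close> (\<open>one_step_conservation_defect\<close>), and the remainder of the relaxation update changes
\<open>\<eta>\<close> by the same order. A displacement of length \<open>l\<close> changes \<open>\<eta>\<close> by \<open>l * (ct * h + o(h)) + O(l\<^sup>2)\<close>.
With \<open>l = a * h ^ p\<close> this is \<open>a * ct * h ^ (p + 1)\<close> to leading order, where \<open>p \<ge> 2\<close> makes the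
quadratic term negligible (\<open>eta_along_branch\<close>). For a large fixed \<open>a\<close> the correction therefore outweighs the
defect with either sign, and the intermediate value theorem gives a root with \<open>\<bar>l\<bar> \<le> a * h ^ p\<close>
(\<open>roots_on_branch\<close>).

If \<open>norm d\<close> is of exact size \<open>h powr q\<close>, then \<open>\<gamma> - 1 = l / (h * norm d)\<close> has size
\<open>h powr (p - 1 - q)\<close> (\<open>branch_rate\<close>), and this exponent is necessarily positive (\<open>rate_exponent_pos\<close>). For
uniqueness, two roots at distance \<open>\<Delta>\<close> with this rate are compared directly: the Lipschitz conditions in \<open>\<gamma>\<close>
make all errors in the difference of the two values of \<open>\<eta>\<close> small compared with \<open>h\<^sup>2 * h powr q * \<Delta>\<close>, while
the linear term is at least a positive multiple of it (\<open>root_with_rate_unique\<close>).\<close>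

section \<open>Asymptotic estimates\<close>

lemma power_tendsto_0_at_right:
  "0 < n \<Longrightarrow> ((\<lambda>h::real. h ^ n) \<longlongrightarrow> 0) (at_right 0)"
  by (rule tendsto_eq_intros refl | simp)+

lemma bigo_tendsto_zero:
  fixes f g :: "'b \<Rightarrow> real"
  assumes "f \<in> O[F](g)" "(g \<longlongrightarrow> 0) F"
  shows "(f \<longlongrightarrow> 0) F"
proof -
  have "g \<in> o[F](\<lambda>_. 1)" using assms(2) by (intro smalloI_tendsto) auto
  with assms(1) have "f \<in> o[F](\<lambda>_. 1)" by (rule landau_o.big_small_trans)
  thus ?thesis using smalloD_tendsto by fastforce
qed

lemma bigo_prod_principalE:
  fixes F :: "'b \<Rightarrow> 'c \<Rightarrow> real"
  assumes "(\<lambda>(h, x). F h x) \<in> O[G \<times>\<^sub>F principal S](\<lambda>(h, x). \<phi> h)"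
  obtains C where "0 < C" "\<forall>\<^sub>F h in G. \<forall>x\<in>S. \<bar>F h x\<bar> \<le> C * \<bar>\<phi> h\<bar>"
proof -
  obtain C where "0 < C"
    and C: "\<forall>\<^sub>F z in G \<times>\<^sub>F principal S. norm (case z of (h, x) \<Rightarrow> F h x) \<le> C * norm (case z of (h, x) \<Rightarrow> \<phi> h)"
    using assms by (rule landau_o.bigE)
  have "\<forall>\<^sub>F h in G. \<forall>x\<in>S. \<bar>F h x\<bar> \<le> C * \<bar>\<phi> h\<bar>"
    using C unfolding eventually_prod_filter eventually_principal
    by (auto elim!: eventually_mono)
  with \<open>0 < C\<close> that show ?thesis by blast
qed

text \<open>With \<open>h powr q\<close> the size of the direction and \<open>h powr (p - 1 - q)\<close> the size of \<open>\<gamma> - 1\<close>, this says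
that the displacement \<open>(\<gamma> - 1) * h * norm d\<close> has size \<open>h ^ p\<close>.\<close>

lemma power_eq_powr_split:
  fixes h q :: real
  assumes "0 < h"
  shows "h ^ p = h * h powr q * h powr (real p - 1 - q)"
proof -
  have "h * h powr q * h powr (real p - 1 - q) = h powr (1 + q + (real p - 1 - q))"
    using assms by (simp only: powr_add powr_one)
  thus ?thesis using assms by (simp add: powr_realpow)
qed

lemma bigtheta_prod_principalE:
  fixes F :: "real \<Rightarrow> 'c \<Rightarrow> real"
  assumes "(\<lambda>(h, x). F h x) \<in> \<Theta>[at_right 0 \<times>\<^sub>F principal S](\<lambda>(h, x). h powr q)"
  obtains C c where "0 < C" "0 < c"
    "\<forall>\<^sub>F h in at_right 0. \<forall>x\<in>S. c * h powr q \<le> \<bar>F h x\<bar> \<and> \<bar>F h x\<bar> \<le> C * h powr q"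
proof -
  from assms have up: "(\<lambda>(h, x). F h x) \<in> O[at_right 0 \<times>\<^sub>F principal S](\<lambda>(h, x). h powr q)"
    and lo: "(\<lambda>(h, x). h powr q) \<in> O[at_right 0 \<times>\<^sub>F principal S](\<lambda>(h, x). F h x)"
    by (auto simp: bigtheta_def bigomega_iff_bigo)
  obtain C where "0 < C" and C: "\<forall>\<^sub>F h in at_right 0. \<forall>x\<in>S. \<bar>F h x\<bar> \<le> C * \<bar>h powr q\<bar>"
    using bigo_prod_principalE[OF up] .
  obtain b where "0 < b" and b: "\<forall>\<^sub>F z in at_right 0 \<times>\<^sub>F principal S.
      norm (case z of (h, x) \<Rightarrow> h powr q) \<le> b * norm (case z of (h, x) \<Rightarrow> F h x)"
    using lo by (rule landau_o.bigE)
  have "\<forall>\<^sub>F h in at_right 0. \<forall>x\<in>S. h powr q \<le> b * \<bar>F h x\<bar>"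
    using b unfolding eventually_prod_filter eventually_principal
    by (auto elim!: eventually_mono)
  with C have "\<forall>\<^sub>F h in at_right 0. \<forall>x\<in>S. inverse b * h powr q \<le> \<bar>F h x\<bar> \<and> \<bar>F h x\<bar> \<le> C * h powr q"
    by eventually_elim (use \<open>0 < b\<close> in \<open>auto simp: field_simps\<close>)
  with \<open>0 < C\<close> \<open>0 < b\<close> that[of C "inverse b"] show ?thesis by simp
qed

lemma lipschitz_bigoE:
  assumes "lipschitz_bigo S F \<phi>"
  obtains C where "0 \<le> C"
    and "\<forall>\<^sub>F h in at_right 0. \<forall>x\<in>S. \<forall>y\<in>S. dist (F h x) (F h y) \<le> C * \<bar>\<phi> h\<bar> * dist x y"
proof -
  obtain C where C: "\<forall>\<^sub>F h in at_right 0. (C * \<phi> h)-lipschitz_on S (F h)"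
    using assms unfolding lipschitz_bigo_def by blast
  have "\<forall>\<^sub>F h in at_right 0. \<forall>x\<in>S. \<forall>y\<in>S. dist (F h x) (F h y) \<le> \<bar>C\<bar> * \<bar>\<phi> h\<bar> * dist x y"
    using C
  proof eventually_elim
    case (elim h)
    have "C * \<phi> h \<le> \<bar>C\<bar> * \<bar>\<phi> h\<bar>" by (metis abs_ge_self abs_mult)
    from lipschitz_on_mono[OF elim order_refl this] show ?case
      by (auto dest: lipschitz_onD)
  qed
  with that[of "\<bar>C\<bar>"] show ?thesis by simp
qed

lemma powr_rate_bound:
  fixes g :: "real \<Rightarrow> real"
  assumes "g \<in> O[at_right 0](\<lambda>h. h powr s)"
  obtains B where "0 < B" "\<forall>\<^sub>F h in at_right 0. \<bar>g h\<bar> \<le> B * h powr s"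
proof -
  obtain B where "0 < B" "\<forall>\<^sub>F h in at_right 0. norm (g h) \<le> B * norm (h powr s)"
    using assms by (rule landau_o.bigE)
  with that[of B] show ?thesis by simp
qed

section \<open>Local expansion of a twice continuously differentiable functional\<close>

text \<open>Near \<open>x0\<close> the second derivative is bounded, so the first derivative is Lipschitz with some constant
\<open>K\<close>, and the mean value inequality applies to \<open>\<eta> - \<eta>' a\<close> on the segment from \<open>x\<close> to \<open>y\<close>. The
derivative is taken at a third point \<open>a\<close>: with \<open>y = a\<close> this is the Taylor estimate that yields a
root, and with \<open>x\<close>, \<open>y\<close> two relaxed states and \<open>a\<close> the baseline step it is an error bound
proportional to \<open>norm (x - y)\<close>, from which uniqueness follows.\<close>

lemma C2_functional_local_expansion:
  fixes \<eta> :: "'a::real_normed_vector \<Rightarrow> real"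
  assumes "C2_functional \<eta>"
  obtains \<rho> L K where "0 < \<rho>" "0 \<le> L" "0 \<le> K"
    and "\<And>a v. a \<in> ball x0 \<rho> \<Longrightarrow> \<bar>frechet_derivative \<eta> (at a) v\<bar> \<le> L * norm v"
    and "\<And>a x y. \<lbrakk>a \<in> ball x0 \<rho>; x \<in> ball x0 \<rho>; y \<in> ball x0 \<rho>\<rbrakk> \<Longrightarrow>
           \<bar>\<eta> x - \<eta> y - frechet_derivative \<eta> (at a) (x - y)\<bar>
             \<le> K * (norm (x - a) + norm (y - a)) * norm (x - y)"
proof -
  obtain D :: "'a \<Rightarrow> 'a \<Rightarrow>\<^sub>L real" and D2
    where D: "\<And>x. (\<eta> has_derivative blinfun_apply (D x)) (at x)"
      and D2: "\<And>x. (D has_derivative blinfun_apply (D2 x)) (at x)"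
      and cont: "continuous_on UNIV D2"
    using assms unfolding C2_functional_def by metis
  have fd: "frechet_derivative \<eta> (at x) = blinfun_apply (D x)" for x
    using frechet_derivative_at[OF D] by simp
  define K where "K = norm (D2 x0) + 1"
  have "isCont D2 x0"
    using cont by (simp add: continuous_on_eq_continuous_at)
  then obtain \<rho> where "\<rho> > 0" and \<rho>: "\<And>z. dist z x0 < \<rho> \<Longrightarrow> dist (D2 z) (D2 x0) < 1"
    unfolding continuous_at_eps_delta using zero_less_one by blast
  have D2_bound: "norm (D2 z) \<le> K" if "z \<in> ball x0 \<rho>" for z
  proof -
    have "norm (D2 z - D2 x0) < 1"
      using \<rho>[of z] that by (simp add: dist_commute flip: dist_norm)
    thus ?thesis using norm_triangle_ineq2[of "D2 z" "D2 x0"] by (simp add: K_def)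
  qed
  have D_lip: "norm (D x - D y) \<le> K * norm (x - y)" if "x \<in> ball x0 \<rho>" "y \<in> ball x0 \<rho>" for x y
  proof (rule differentiable_bound[where S = "ball x0 \<rho>" and f' = "\<lambda>x. blinfun_apply (D2 x)"])
    show "onorm (blinfun_apply (D2 z)) \<le> K" if "z \<in> ball x0 \<rho>" for z
      using D2_bound[OF that] by (simp add: norm_blinfun.rep_eq)
  qed (use that D2 in \<open>auto intro: has_derivative_at_withinI\<close>)
  have "0 \<le> K" by (simp add: K_def)
  show ?thesis
  proof (rule that[of \<rho> "norm (D x0) + K * \<rho>" K])
    show "0 < \<rho>" "0 \<le> K" by fact+
    show "0 \<le> norm (D x0) + K * \<rho>" using \<open>0 < \<rho>\<close> \<open>0 \<le> K\<close> by simp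
  next
    fix a v :: 'a assume a: "a \<in> ball x0 \<rho>"
    have "norm (D a - D x0) \<le> K * \<rho>"
    proof -
      have "K * norm (a - x0) \<le> K * \<rho>"
        using a \<open>0 \<le> K\<close> by (intro mult_left_mono) (auto simp: dist_norm norm_minus_commute)
      with D_lip[OF a, of x0] \<open>\<rho> > 0\<close> show ?thesis by simp
    qed
    hence "norm (D a) \<le> norm (D x0) + K * \<rho>"
      using norm_triangle_ineq2[of "D a" "D x0"] by simp
    hence "norm (D a) * norm v \<le> (norm (D x0) + K * \<rho>) * norm v"
      by (rule mult_right_mono) simp
    thus "\<bar>frechet_derivative \<eta> (at a) v\<bar> \<le> (norm (D x0) + K * \<rho>) * norm v"
      using norm_blinfun[of "D a" v] by (simp add: fd)
  next
    fix a x y assume a: "a \<in> ball x0 \<rho>" and x: "x \<in> ball x0 \<rho>" and y: "y \<in> ball x0 \<rho>"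
    have seg: "closed_segment x y \<subseteq> ball x0 \<rho>"
      using x y by (simp add: closed_segment_subset)
    \<comment> \<open>On the segment the derivative of the difference is \<open>D z - D a\<close>, at most \<open>K * norm (z - a)\<close>.\<close>
    have "norm ((\<eta> x - D a x) - (\<eta> y - D a y)) \<le> K * (norm (x - a) + norm (y - a)) * norm (x - y)"
    proof (rule differentiable_bound[where S = "closed_segment x y" and f' = "\<lambda>z. blinfun_apply (D z - D a)"])
      fix z assume z: "z \<in> closed_segment x y"
      show "((\<lambda>z. \<eta> z - D a z) has_derivative blinfun_apply (D z - D a)) (at z within closed_segment x y)"
        unfolding minus_blinfun.rep_eq
        by (intro has_derivative_diff has_derivative_at_withinI[OF D] bounded_linear_imp_has_derivative
            blinfun.bounded_linear_right)
      have "closed_segment x y \<subseteq> cball a (max (norm (x - a)) (norm (y - a)))"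
        by (intro closed_segment_subset convex_cball) (auto simp: dist_norm norm_minus_commute)
      hence "norm (z - a) \<le> max (norm (x - a)) (norm (y - a))"
        using z by (auto simp: dist_norm norm_minus_commute)
      also have "\<dots> \<le> norm (x - a) + norm (y - a)" by simp
      finally have "K * norm (z - a) \<le> K * (norm (x - a) + norm (y - a))"
        using \<open>0 \<le> K\<close> by (rule mult_left_mono)
      with D_lip[of z a] z seg a
      show "onorm (blinfun_apply (D z - D a)) \<le> K * (norm (x - a) + norm (y - a))"
        by (force simp: norm_blinfun.rep_eq)
    qed auto
    thus "\<bar>\<eta> x - \<eta> y - frechet_derivative \<eta> (at a) (x - y)\<bar>
             \<le> K * (norm (x - a) + norm (y - a)) * norm (x - y)"
      by (simp add: fd blinfun.diff_right algebra_simps)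
  qed
qed

lemma frechet_derivative_eq_normalized_slope:
  assumes "\<eta> differentiable (at x)"
  shows "frechet_derivative \<eta> (at x) (t *\<^sub>R v) = t * norm v * normalized_slope \<eta> x v"
proof -
  interpret linear "frechet_derivative \<eta> (at x)"
    using assms by (rule linear_frechet_derivative)
  show ?thesis by (cases "v = 0") (simp_all add: normalized_slope_def scaleR zero)
qed

section \<open>Conservation defect of a one-step method\<close>

lemma local_solution_tendsto:
  assumes "local_solution f t0 u0 u"
  shows "((\<lambda>h. u (t0 + h)) \<longlongrightarrow> u0) (at_right 0)"
proof -
  obtain T where "T > 0"
    and T: "\<And>t. t \<in> {t0..<t0 + T} \<Longrightarrow> (u has_vector_derivative f (u t)) (at t within {t0..<t0 + T})"
    and "u t0 = u0"
    using assms unfolding local_solution_def by auto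
  have "continuous (at t0 within {t0..<t0 + T}) u"
    using T[of t0] \<open>T > 0\<close> by (auto intro: has_vector_derivative_continuous)
  hence "(u \<longlongrightarrow> u0) (at t0 within {t0..<t0 + T})"
    using \<open>u t0 = u0\<close> by (simp add: continuous_within)
  moreover have "filterlim (\<lambda>h. t0 + h) (at t0 within {t0..<t0 + T}) (at_right 0)"
    unfolding filterlim_at
  proof
    show "\<forall>\<^sub>F h in at_right 0. t0 + h \<in> {t0..<t0 + T} \<and> t0 + h \<noteq> t0"
      using \<open>T > 0\<close> by (auto simp: eventually_at_right_field)
    show "((+) t0 \<longlongrightarrow> t0) (at_right 0)"
      by (rule tendsto_eq_intros refl | simp)+
  qed
  ultimately show ?thesis by (rule filterlim_compose)
qed

text \<open>By the chain rule the derivative of \<open>\<eta> \<circ> u\<close> is \<open>\<eta>' (u t) (f (u t))\<close>, which conservation makes zero.\<close>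

lemma conserved_along_local_solution:
  assumes sol: "local_solution f t0 u0 u" and cons: "conserves f \<eta>"
    and diff: "\<And>x. \<eta> differentiable (at x)"
  shows "\<forall>\<^sub>F h in at_right 0. \<eta> (u (t0 + h)) = \<eta> u0"
proof -
  obtain T where "T > 0"
    and T: "\<And>t. t \<in> {t0..<t0 + T} \<Longrightarrow> (u has_vector_derivative f (u t)) (at t within {t0..<t0 + T})"
    and "u t0 = u0"
    using sol unfolding local_solution_def by auto
  have deriv: "((\<lambda>t. \<eta> (u t)) has_derivative (\<lambda>_. 0)) (at t within {t0..<t0 + T})"
    if t: "t \<in> {t0..<t0 + T}" for t
  proof -
    have \<eta>': "(\<eta> has_derivative frechet_derivative \<eta> (at (u t))) (at (u t))"
      using diff frechet_derivative_works by blast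
    then interpret bounded_linear "frechet_derivative \<eta> (at (u t))"
      by (rule has_derivative_bounded_linear)
    have "frechet_derivative \<eta> (at (u t)) (s *\<^sub>R f (u t)) = 0" for s
      using cons by (simp add: conserves_def scaleR)
    with has_derivative_compose[OF T[OF t, unfolded has_vector_derivative_def] \<eta>']
    show ?thesis by simp
  qed
  have "\<eta> (u t) = \<eta> (u t0)" if "t \<in> {t0..<t0 + T}" for t
    using has_derivative_zero_unique[of "{t0..<t0 + T}" "\<lambda>t. \<eta> (u t)" t t0] deriv that \<open>T > 0\<close> by auto
  hence "\<eta> (u (t0 + h)) = \<eta> u0" if "0 < h" "h < T" for h
    using that \<open>u t0 = u0\<close> by simp
  thus ?thesis
    using \<open>T > 0\<close> by (auto simp: eventually_at_right_field)
qed

lemma one_step_tendsto: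
  assumes sol: "local_solution f t0 u0 u" and order: "has_order_at f \<Phi> u0 p"
  shows "((\<lambda>h. \<Phi> h u0) \<longlongrightarrow> u0) (at_right 0)"
proof -
  have "(\<lambda>h. norm (\<Phi> h u0 - u (t0 + h))) \<in> O[at_right 0](\<lambda>h. h ^ (p + 1))"
    using assms unfolding has_order_at_def by blast
  moreover have "((\<lambda>h::real. h ^ (p + 1)) \<longlongrightarrow> 0) (at_right 0)"
    by (rule power_tendsto_0_at_right) simp
  ultimately have "((\<lambda>h. norm (\<Phi> h u0 - u (t0 + h))) \<longlongrightarrow> 0) (at_right 0)"
    by (rule bigo_tendsto_zero)
  hence "((\<lambda>h. \<Phi> h u0 - u (t0 + h)) \<longlongrightarrow> 0) (at_right 0)"
    by (rule tendsto_norm_zero_cancel)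
  from tendsto_add[OF this local_solution_tendsto[OF sol]] show ?thesis by simp
qed

text \<open>The exact solution keeps \<open>\<eta>\<close> constant and the baseline step differs from it by \<open>O(h ^ (p + 1))\<close>; a
\<open>C\<^sup>2\<close> functional is locally Lipschitz, so its value inherits this error.\<close>

lemma one_step_conservation_defect:
  assumes \<eta>: "C2_functional \<eta>" and cons: "conserves f \<eta>"
    and sol: "local_solution f t0 u0 u" and order: "has_order_at f \<Phi> u0 p"
  shows "(\<lambda>h. \<eta> (\<Phi> h u0) - \<eta> u0) \<in> O[at_right 0](\<lambda>h. h ^ (p + 1))"
proof -
  from C2_functional_local_expansion[OF \<eta>, where ?x0.0 = u0]
  obtain \<rho> L K where "0 < \<rho>" "0 \<le> L" "0 \<le> K"
    and L: "\<And>a v. a \<in> ball u0 \<rho> \<Longrightarrow> \<bar>frechet_derivative \<eta> (at a) v\<bar> \<le> L * norm v"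
    and K: "\<And>a x y. \<lbrakk>a \<in> ball u0 \<rho>; x \<in> ball u0 \<rho>; y \<in> ball u0 \<rho>\<rbrakk> \<Longrightarrow>
           \<bar>\<eta> x - \<eta> y - frechet_derivative \<eta> (at a) (x - y)\<bar>
             \<le> K * (norm (x - a) + norm (y - a)) * norm (x - y)"
    by blast
  have diff: "\<eta> differentiable (at x)" for x
    using \<eta> unfolding C2_functional_def differentiable_def by blast
  have near: "\<forall>\<^sub>F h in at_right 0. w h \<in> ball u0 \<rho>" if "(w \<longlongrightarrow> u0) (at_right 0)" for w :: "real \<Rightarrow> _"
    using tendstoD[OF that \<open>0 < \<rho>\<close>] by (simp add: dist_commute)
  have "(\<lambda>h. \<eta> (\<Phi> h u0) - \<eta> u0) \<in> O[at_right 0](\<lambda>h. norm (\<Phi> h u0 - u (t0 + h)))"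
  proof (rule bigoI[where c = "L + K * (2 * \<rho>)"])
    show "\<forall>\<^sub>F h in at_right 0. norm (\<eta> (\<Phi> h u0) - \<eta> u0)
            \<le> (L + K * (2 * \<rho>)) * norm (norm (\<Phi> h u0 - u (t0 + h)))"
      using near[OF one_step_tendsto[OF sol order]] near[OF local_solution_tendsto[OF sol]]
        conserved_along_local_solution[OF sol cons diff]
    proof eventually_elim
      case (elim h)
      let ?x = "\<Phi> h u0" and ?y = "u (t0 + h)"
      have "norm (?x - ?y) \<le> 2 * \<rho>"
        using elim(1,2) dist_triangle[of ?x ?y u0] by (simp add: dist_norm norm_minus_commute)
      hence "K * norm (?x - ?y) * norm (?x - ?y) \<le> K * (2 * \<rho>) * norm (?x - ?y)"
        using \<open>0 \<le> K\<close> by (intro mult_right_mono mult_left_mono) auto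
      with L[OF elim(2), of "?x - ?y"] K[OF elim(2,1,2)] elim(3)
      show ?case by (simp add: algebra_simps)
    qed
  qed
  also have "(\<lambda>h. norm (\<Phi> h u0 - u (t0 + h))) \<in> O[at_right 0](\<lambda>h. h ^ (p + 1))"
    using sol order unfolding has_order_at_def by blast
  finally show ?thesis .
qed

section \<open>Roots along the branch\<close>

text \<open>One relaxed step from the fixed state \<open>un\<close>. The accuracy of the baseline method is expressed by the
defect of its result \<open>A h\<close> in the conserved functional, so that \<open>A\<close> can be any small perturbation
of \<open>un\<close> with such a defect.\<close>

locale relaxed_step =
  fixes \<eta> :: "'a::real_normed_vector \<Rightarrow> real"
    and A :: "real \<Rightarrow> 'a" and un :: 'a and p :: nat and V :: "real set"
    and urel d :: "real \<Rightarrow> real \<Rightarrow> 'a"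
    and gt :: "real \<Rightarrow> real \<Rightarrow> real" and r :: "real \<Rightarrow> real"
    and c :: "real \<Rightarrow> real" and ct :: real
  assumes eta_C2: "C2_functional \<eta>"
    and base_tendsto: "(A \<longlongrightarrow> un) (at_right 0)"
    and defect: "(\<lambda>h. \<eta> (A h) - \<eta> un) \<in> O[at_right 0](\<lambda>h. h ^ (p + 1))"
    and p_ge_2: "2 \<le> p"
    and update:
      "(\<lambda>(h, \<gamma>). norm (urel h \<gamma> - (A h + ((\<gamma> - 1) * h) *\<^sub>R d h \<gamma>)))
         \<in> O[at_right 0 \<times>\<^sub>F principal V](\<lambda>(h, \<gamma>). h ^ (p + 1))"
    and update_cont: "\<forall>\<^sub>F h in at_right 0. continuous_on V (urel h)"
    and branch: "\<forall>\<^sub>F h in at_right 0. implicit_branch V (d h) h (r h) (gt h)"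
    and branch_domain: "(\<lambda>h. h ^ p) \<in> o[at_right 0](r)"
    and slope:
      "(\<lambda>(h, \<mu>). normalized_slope \<eta> (A h) (d h (gt h (h * \<mu>))) - c \<mu> * h)
         \<in> O[inf (at_right 0 \<times>\<^sub>F nhds 0) (principal {(h, \<mu>). \<bar>h * \<mu>\<bar> < r h})](\<lambda>(h, \<mu>). h ^ 2)"
    and c_lim: "(c \<longlongrightarrow> ct) (at 0)" "ct \<noteq> 0"
begin

lemma eta_differentiable: "\<eta> differentiable (at x)"
  using eta_C2 unfolding C2_functional_def differentiable_def by blast

lemma eta'_diff: "frechet_derivative \<eta> (at x) (v - w) = frechet_derivative \<eta> (at x) v - frechet_derivative \<eta> (at x) w"
  by (rule linear_diff[OF linear_frechet_derivative[OF eta_differentiable]])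

lemma eta'_add: "frechet_derivative \<eta> (at x) (v + w) = frechet_derivative \<eta> (at x) v + frechet_derivative \<eta> (at x) w"
  by (rule linear_add[OF linear_frechet_derivative[OF eta_differentiable]])

abbreviation slope_at :: "real \<Rightarrow> real \<Rightarrow> real" where
  "slope_at h \<gamma> \<equiv> normalized_slope \<eta> (A h) (d h \<gamma>)"

abbreviation remainder :: "real \<Rightarrow> real \<Rightarrow> 'a" where
  "remainder h \<gamma> \<equiv> urel h \<gamma> - (A h + ((\<gamma> - 1) * h) *\<^sub>R d h \<gamma>)"

lemma remainder_bound:
  obtains E where "0 < E" "\<forall>\<^sub>F h in at_right 0. \<forall>\<gamma>\<in>V. norm (remainder h \<gamma>) \<le> E * h ^ (p + 1)"
proof -
  obtain E where "0 < E"
    and E: "\<forall>\<^sub>F h in at_right 0. \<forall>\<gamma>\<in>V. \<bar>norm (remainder h \<gamma>)\<bar> \<le> E * \<bar>h ^ (p + 1)\<bar>"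
    using bigo_prod_principalE[OF update] .
  have "\<forall>\<^sub>F h in at_right 0. \<forall>\<gamma>\<in>V. norm (remainder h \<gamma>) \<le> E * h ^ (p + 1)"
    using E eventually_at_right_less[of "0::real"] by eventually_elim auto
  with \<open>0 < E\<close> that show ?thesis by blast
qed

text \<open>Since \<open>h ^ p = o(r)\<close>, every multiple of \<open>h ^ p\<close> is eventually a parameter of the branch. The sizes at
which roots are sought are of this form.\<close>

lemma branch_reaches: "\<forall>\<^sub>F h in at_right 0. a * h ^ p < r h"
proof -
  have "\<forall>\<^sub>F h in at_right 0. norm (h ^ p) \<le> inverse (\<bar>a\<bar> + 1) * norm (r h)"
    by (rule landau_o.smallD[OF branch_domain]) simp
  thus ?thesis using branch eventually_at_right_less[of "0::real"]
  proof eventually_elim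
    case (elim h)
    hence "r h > 0" and *: "(\<bar>a\<bar> + 1) * h ^ p \<le> r h"
      by (auto simp: implicit_branch_def field_simps abs_if split: if_splits)
    have "a * h ^ p < (\<bar>a\<bar> + 1) * h ^ p"
      using elim(3) by (intro mult_strict_right_mono) auto
    with * show ?case by linarith
  qed
qed

lemma branch_reaches_abs: "\<forall>\<^sub>F h in at_right 0. \<bar>a * h ^ p\<bar> < r h"
  using branch_reaches[of "\<bar>a\<bar>"] eventually_at_right_less[of "0::real"]
  by eventually_elim (simp add: abs_mult)

text \<open>The slope hypothesis describes \<open>l = h * \<mu>\<close> for all small \<open>\<mu>\<close> simultaneously, so \<open>\<mu>\<close> may depend on \<open>h\<close>.
Here \<open>\<mu> = a * h ^ (p - 1)\<close>, which tends to \<open>0\<close> because \<open>p \<ge> 2\<close>; it has to stay away from \<open>0\<close>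
itself because the limit of \<open>c\<close> says nothing about \<open>c 0\<close>.\<close>

lemma slope_along_branch:
  assumes "a \<noteq> 0" "\<epsilon> > 0"
  shows "\<forall>\<^sub>F h in at_right 0. \<bar>slope_at h (gt h (a * h ^ p)) - ct * h\<bar> \<le> \<epsilon> * h"
proof -
  obtain S where "0 < S" and
    "\<forall>\<^sub>F z in inf (at_right 0 \<times>\<^sub>F nhds 0) (principal {(h, \<mu>). \<bar>h * \<mu>\<bar> < r h}).
      norm (case z of (h, \<mu>) \<Rightarrow> slope_at h (gt h (h * \<mu>)) - c \<mu> * h) \<le> S * norm (case z of (h, \<mu>) \<Rightarrow> h ^ 2)"
    using slope by (rule landau_o.bigE)
  hence S: "\<forall>\<^sub>F z in at_right 0 \<times>\<^sub>F nhds 0. \<bar>fst z * snd z\<bar> < r (fst z) \<longrightarrow>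
      \<bar>slope_at (fst z) (gt (fst z) (fst z * snd z)) - c (snd z) * fst z\<bar> \<le> S * (fst z)\<^sup>2"
    by (simp add: eventually_inf_principal case_prod_unfold)
  let ?\<mu> = "\<lambda>h::real. a * h ^ (p - 1)"
  have \<mu>_lim: "(?\<mu> \<longlongrightarrow> 0) (at_right 0)"
    using p_ge_2 by (intro tendsto_mult_right_zero power_tendsto_0_at_right) simp
  hence "filterlim (\<lambda>h. (h, ?\<mu> h)) (at_right 0 \<times>\<^sub>F nhds 0) (at_right 0)"
    by (intro filterlim_Pair filterlim_ident)
  from eventually_compose_filterlim[OF S this]
  have near: "\<forall>\<^sub>F h in at_right 0. \<bar>h * ?\<mu> h\<bar> < r h \<longrightarrow>
      \<bar>slope_at h (gt h (h * ?\<mu> h)) - c (?\<mu> h) * h\<bar> \<le> S * h\<^sup>2"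
    by simp
  have "filterlim ?\<mu> (at 0) (at_right 0)"
    unfolding filterlim_at
  proof
    show "\<forall>\<^sub>F h in at_right 0. ?\<mu> h \<in> UNIV \<and> ?\<mu> h \<noteq> 0"
      using eventually_at_right_less[of "0::real"]
      by eventually_elim (use \<open>a \<noteq> 0\<close> in simp)
  qed (rule \<mu>_lim)
  from filterlim_compose[OF c_lim(1) this]
  have c_near: "\<forall>\<^sub>F h in at_right 0. \<bar>c (?\<mu> h) - ct\<bar> < \<epsilon> / 2"
    using tendstoD[of _ ct "at_right 0" "\<epsilon> / 2"] \<open>\<epsilon> > 0\<close> by (simp add: dist_real_def)
  have "((\<lambda>h. S * h) \<longlongrightarrow> 0) (at_right 0)"
    by (rule tendsto_eq_intros refl | simp)+
  hence small: "\<forall>\<^sub>F h in at_right 0. S * h < \<epsilon> / 2"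
    using \<open>\<epsilon> > 0\<close> by (intro order_tendstoD(2)) auto
  show ?thesis
    using near c_near small branch_reaches_abs[of a] eventually_at_right_less[of "0::real"]
  proof eventually_elim
    case (elim h)
    have \<mu>: "h * ?\<mu> h = a * h ^ p"
      using p_ge_2 by (cases p) auto
    have "S * h\<^sup>2 \<le> \<epsilon> / 2 * h"
      using mult_right_mono[of "S * h" "\<epsilon> / 2" h] elim by (simp add: power2_eq_square)
    moreover have "\<bar>(c (?\<mu> h) - ct) * h\<bar> \<le> \<epsilon> / 2 * h"
      unfolding abs_mult using elim \<open>\<epsilon> > 0\<close> by (intro mult_mono) auto
    ultimately show ?case
      using elim(1,4) unfolding \<mu> left_diff_distrib by linarith
  qed
qed

lemma branch_step:
  assumes "implicit_branch V (d h) h (r h) (gt h)" "\<bar>l\<bar> < r h"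
  shows "gt h l \<in> V" "0 < gt h l" "(gt h l - 1) * h * norm (d h (gt h l)) = l"
proof -
  have "l \<in> {- r h<..<r h}" using assms(2) by auto
  thus "gt h l \<in> V" "0 < gt h l" "(gt h l - 1) * h * norm (d h (gt h l)) = l"
    using assms(1) unfolding implicit_branch_def by metis+
qed

text \<open>Along the branch the displacement from \<open>A h\<close> is \<open>l\<close> times a unit vector, up to \<open>O(h ^ (p + 1))\<close>. For
\<open>l = a * h ^ p\<close> the linear term is therefore \<open>a * ct * h ^ (p + 1)\<close> to leading order. The
conservation defect and the remainder of the relaxation update are of the same order, but their
constants do not involve \<open>a\<close>, and everything that does involve \<open>a\<close> is of higher order. It is essential
that \<open>K\<close> is chosen before \<open>a\<close>.\<close>

lemma eta_along_branch:
  "\<exists>K. \<forall>a. a \<noteq> 0 \<longrightarrow> (\<forall>\<^sub>F h in at_right 0.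
     \<bar>\<eta> (urel h (gt h (a * h ^ p))) - \<eta> un - a * ct * h ^ (p + 1)\<bar> \<le> K * h ^ (p + 1))"
proof -
  from C2_functional_local_expansion[OF eta_C2, where ?x0.0 = un]
  obtain \<rho> L K where "0 < \<rho>" "0 \<le> L" "0 \<le> K"
    and L: "\<And>a v. a \<in> ball un \<rho> \<Longrightarrow> \<bar>frechet_derivative \<eta> (at a) v\<bar> \<le> L * norm v"
    and K: "\<And>a x y. \<lbrakk>a \<in> ball un \<rho>; x \<in> ball un \<rho>; y \<in> ball un \<rho>\<rbrakk> \<Longrightarrow>
           \<bar>\<eta> x - \<eta> y - frechet_derivative \<eta> (at a) (x - y)\<bar>
             \<le> K * (norm (x - a) + norm (y - a)) * norm (x - y)"
    by blast
  obtain E where "0 < E"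
    and E: "\<forall>\<^sub>F h in at_right 0. \<forall>\<gamma>\<in>V. norm (remainder h \<gamma>) \<le> E * h ^ (p + 1)"
    using remainder_bound .
  obtain M where "0 < M" and M: "\<forall>\<^sub>F h in at_right 0. norm (\<eta> (A h) - \<eta> un) \<le> M * norm (h ^ (p + 1))"
    using defect by (rule landau_o.bigE)
  have "\<forall>\<^sub>F h in at_right 0.
     \<bar>\<eta> (urel h (gt h (a * h ^ p))) - \<eta> un - a * ct * h ^ (p + 1)\<bar> \<le> (L * E + M + 2) * h ^ (p + 1)"
    if "a \<noteq> 0" for a
  proof -
    have "((\<lambda>h. (\<bar>a\<bar> + E) * h ^ p) \<longlongrightarrow> 0) (at_right 0)"
      using p_ge_2 by (intro tendsto_mult_right_zero power_tendsto_0_at_right) simp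
    hence step_small: "\<forall>\<^sub>F h in at_right 0. (\<bar>a\<bar> + E) * h ^ p < \<rho> / 2"
      using \<open>0 < \<rho>\<close> by (intro order_tendstoD(2)) auto
    have "((\<lambda>h. K * (\<bar>a\<bar> + E)\<^sup>2 * h ^ (p - 1)) \<longlongrightarrow> 0) (at_right 0)"
      using p_ge_2 by (intro tendsto_mult_right_zero power_tendsto_0_at_right) simp
    hence quad_small: "\<forall>\<^sub>F h in at_right 0. K * (\<bar>a\<bar> + E)\<^sup>2 * h ^ (p - 1) < 1"
      by (intro order_tendstoD(2)) auto
    have base_near: "\<forall>\<^sub>F h in at_right 0. dist (A h) un < \<rho> / 2"
      using \<open>0 < \<rho>\<close> by (intro tendstoD[OF base_tendsto]) simp
    have slope_near: "\<forall>\<^sub>F h in at_right 0. \<bar>slope_at h (gt h (a * h ^ p)) - ct * h\<bar> \<le> 1 / \<bar>a\<bar> * h"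
      using \<open>a \<noteq> 0\<close> by (intro slope_along_branch) auto
    have "\<forall>\<^sub>F h::real in at_right 0. h < 1"
      by (auto simp: eventually_at_right_field intro: exI[of _ 1])
    thus ?thesis
      using E M step_small quad_small base_near slope_near branch branch_reaches_abs[of a]
        eventually_at_right_less[of "0::real"]
    proof eventually_elim
      case (elim h)
      define l where "l = a * h ^ p"
      define \<gamma> where "\<gamma> = gt h l"
      have l: "\<bar>l\<bar> < r h" using elim(9) by (simp add: l_def)
      note step = branch_step[OF elim(8) l, folded \<gamma>_def]
      define w where "w = ((\<gamma> - 1) * h) *\<^sub>R d h \<gamma>"
      define e where "e = remainder h \<gamma>"
      have e: "norm e \<le> E * h ^ (p + 1)" using elim(2) step(1) by (auto simp: e_def)
      also have "\<dots> \<le> E * h ^ p"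
        using elim(1,10) \<open>0 < E\<close> by (intro mult_left_mono power_decreasing) auto
      finally have "norm e \<le> E * h ^ p" .
      moreover have "norm w = \<bar>l\<bar>"
        by (simp add: w_def flip: step(3)) (simp add: abs_mult)
      ultimately have size: "norm (urel h \<gamma> - A h) \<le> (\<bar>a\<bar> + E) * h ^ p"
        using norm_triangle_ineq[of w e] elim(10)
        by (simp add: e_def w_def l_def abs_mult algebra_simps)
      have A: "A h \<in> ball un \<rho>" using elim(6) \<open>0 < \<rho>\<close> by (simp add: dist_commute)
      have "dist (urel h \<gamma>) un \<le> norm (urel h \<gamma> - A h) + dist (A h) un"
        using dist_triangle[of "urel h \<gamma>" un "A h"] by (simp add: dist_norm)
      hence "urel h \<gamma> \<in> ball un \<rho>"
        using size elim(4,6) by (simp add: dist_commute)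
      from K[OF A this A]
      have "\<bar>\<eta> (urel h \<gamma>) - \<eta> (A h) - frechet_derivative \<eta> (at (A h)) (urel h \<gamma> - A h)\<bar>
              \<le> K * norm (urel h \<gamma> - A h) * norm (urel h \<gamma> - A h)" by simp
      also have "\<dots> \<le> K * ((\<bar>a\<bar> + E) * h ^ p) * ((\<bar>a\<bar> + E) * h ^ p)"
        using size \<open>0 \<le> K\<close> \<open>0 < E\<close> elim(10) by (intro mult_mono) auto
      \<comment> \<open>\<open>2 * p = (p - 1) + (p + 1)\<close>, and \<open>p - 1 \<ge> 1\<close> leaves a factor that tends to \<open>0\<close>.\<close>
      also have "\<dots> = (K * (\<bar>a\<bar> + E)\<^sup>2 * h ^ (p - 1)) * h ^ (p + 1)"
        using p_ge_2 by (cases p) (simp_all add: power2_eq_square)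
      also have "\<dots> \<le> 1 * h ^ (p + 1)"
        using elim(5,10) by (intro mult_right_mono) auto
      finally have quad: "\<bar>\<eta> (urel h \<gamma>) - \<eta> (A h) - frechet_derivative \<eta> (at (A h)) (urel h \<gamma> - A h)\<bar>
              \<le> h ^ (p + 1)" by simp
      have lin: "frechet_derivative \<eta> (at (A h)) (urel h \<gamma> - A h)
              = l * slope_at h \<gamma> + frechet_derivative \<eta> (at (A h)) e"
      proof -
        have "urel h \<gamma> - A h = w + e" by (simp add: w_def e_def)
        thus ?thesis
          by (simp add: eta'_add w_def frechet_derivative_eq_normalized_slope[OF eta_differentiable] step(3))
      qed
      have "\<bar>frechet_derivative \<eta> (at (A h)) e\<bar> \<le> L * (E * h ^ (p + 1))"
        using L[OF A, of e] mult_left_mono[OF e \<open>0 \<le> L\<close>] by linarith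
      moreover have "\<bar>l * slope_at h \<gamma> - a * ct * h ^ (p + 1)\<bar> \<le> h ^ (p + 1)"
      proof -
        have "l * slope_at h \<gamma> - a * ct * h ^ (p + 1) = a * h ^ p * (slope_at h \<gamma> - ct * h)"
          by (simp add: l_def algebra_simps)
        also have "\<bar>\<dots>\<bar> \<le> (\<bar>a\<bar> * h ^ p) * (1 / \<bar>a\<bar> * h)"
          unfolding abs_mult using elim(7,10) by (intro mult_mono) (auto simp: \<gamma>_def l_def)
        finally show ?thesis using \<open>a \<noteq> 0\<close> by (simp add: mult.commute)
      qed
      moreover have "\<bar>\<eta> (A h) - \<eta> un\<bar> \<le> M * h ^ (p + 1)"
        using elim(3,10) by simp
      ultimately have "\<bar>\<eta> (urel h \<gamma>) - \<eta> un - a * ct * h ^ (p + 1)\<bar> \<le> (L * E + M + 2) * h ^ (p + 1)"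
        using quad unfolding lin by (simp add: distrib_right)
      thus ?case by (simp add: \<gamma>_def l_def)
    qed
  qed
  thus ?thesis by blast
qed

text \<open>Once \<open>a * \<bar>ct\<bar>\<close> exceeds the constant of \<open>eta_along_branch\<close>, the leading terms at \<open>l = a * h ^ p\<close> and
\<open>l = - a * h ^ p\<close>, which have opposite signs, dominate all errors, and the intermediate value theorem
gives a root in between.\<close>

lemma roots_on_branch:
  obtains a where "0 < a"
    and "\<forall>\<^sub>F h in at_right 0. \<exists>l. \<bar>l\<bar> \<le> a * h ^ p \<and> \<bar>l\<bar> < r h \<and> positive_root V \<eta> (urel h) (\<eta> un) (gt h l)"
proof -
  obtain K where K: "\<And>a. a \<noteq> 0 \<Longrightarrow> \<forall>\<^sub>F h in at_right 0.
     \<bar>\<eta> (urel h (gt h (a * h ^ p))) - \<eta> un - a * ct * h ^ (p + 1)\<bar> \<le> K * h ^ (p + 1)"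
    using eta_along_branch by blast
  define a where "a = (\<bar>K\<bar> + 1) / \<bar>ct\<bar>"
  have "0 < a" using c_lim(2) by (simp add: a_def)
  have neg_a: "- a \<noteq> 0" using \<open>0 < a\<close> by simp
  have a_ct: "a * \<bar>ct\<bar> = \<bar>K\<bar> + 1" using c_lim(2) by (simp add: a_def)
  have "\<forall>\<^sub>F h in at_right 0. \<exists>l. \<bar>l\<bar> \<le> a * h ^ p \<and> \<bar>l\<bar> < r h \<and> positive_root V \<eta> (urel h) (\<eta> un) (gt h l)"
    using K[of a, OF less_imp_neq[OF \<open>0 < a\<close>, symmetric]] K[of "- a", OF neg_a] branch branch_reaches[of a]
      update_cont eventually_at_right_less[of "0::real"]
  proof eventually_elim
    case (elim h)
    define b where "b = a * h ^ p"
    have "0 < b" using \<open>0 < a\<close> elim(6) by (simp add: b_def)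
    \<comment> \<open>With the factor \<open>sgn ct\<close>, \<open>G\<close> is nonpositive at \<open>- b\<close> and nonnegative at \<open>b\<close> for either sign of \<open>ct\<close>.\<close>
    define G where "G l = sgn ct * (\<eta> (urel h (gt h l)) - \<eta> un)" for l
    have pos: "0 < h ^ (p + 1)" using elim(6) by simp
    have "K * h ^ (p + 1) \<le> (a * \<bar>ct\<bar>) * h ^ (p + 1)"
      unfolding a_ct using pos by (intro mult_right_mono) auto
    hence strict: "K * h ^ (p + 1) \<le> \<bar>a * ct * h ^ (p + 1)\<bar>"
      using \<open>0 < a\<close> elim(6) by (simp add: abs_mult)
    have ends: "\<bar>\<eta> (urel h (gt h b)) - \<eta> un - a * ct * h ^ (p + 1)\<bar> \<le> K * h ^ (p + 1)"
      "\<bar>\<eta> (urel h (gt h (- b))) - \<eta> un + a * ct * h ^ (p + 1)\<bar> \<le> K * h ^ (p + 1)"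
      using elim(1,2) by (simp_all add: b_def)
    have "G (- b) \<le> 0 \<and> 0 \<le> G b"
    proof (cases "0 < ct")
      case True
      hence "0 \<le> a * ct * h ^ (p + 1)" using \<open>0 < a\<close> pos by simp
      with strict ends True show ?thesis unfolding G_def by (simp add: abs_le_iff)
    next
      case False
      hence "ct < 0" using c_lim(2) by simp
      hence "a * ct * h ^ (p + 1) \<le> 0"
        using \<open>0 < a\<close> pos by (intro mult_nonpos_nonneg mult_nonneg_nonpos) auto
      with strict ends \<open>ct < 0\<close> show ?thesis unfolding G_def by (simp add: abs_le_iff)
    qed
    hence "G (- b) \<le> 0" "0 \<le> G b" by auto
    moreover have "continuous_on {- b..b} G"
    proof -
      have sub: "{- b..b} \<subseteq> {- r h<..<r h}" using elim(4) by (auto simp: b_def)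
      have "continuous_on {- b..b} (gt h)" "gt h ` {- b..b} \<subseteq> V"
        using elim(3) sub by (auto simp: implicit_branch_def intro: continuous_on_subset)
      hence "continuous_on {- b..b} (urel h \<circ> gt h)"
        using elim(5) by (intro continuous_on_compose) (auto intro: continuous_on_subset)
      moreover have "continuous_on UNIV \<eta>"
        by (intro continuous_at_imp_continuous_on ballI differentiable_imp_continuous_within
            eta_differentiable)
      ultimately have "continuous_on {- b..b} (\<lambda>l. \<eta> (urel h (gt h l)))"
        using continuous_on_compose2[of UNIV \<eta> "{- b..b}" "urel h \<circ> gt h"] by (simp add: o_def)
      thus ?thesis unfolding G_def by (intro continuous_intros)
    qed
    ultimately obtain l where "- b \<le> l" "l \<le> b" "G l = 0"
      using IVT'[of G "- b" 0 b] \<open>0 < b\<close> by auto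
    hence l: "\<bar>l\<bar> \<le> b" "\<bar>l\<bar> < r h" and root: "\<eta> (urel h (gt h l)) - \<eta> un = 0"
      using elim(4) c_lim(2) by (auto simp: b_def G_def sgn_eq_0_iff)
    show ?case
      using l root branch_step[OF elim(3) l(2)] by (auto simp: positive_root_def b_def)
  qed
  with \<open>0 < a\<close> that show ?thesis by blast
qed

section \<open>Rate of convergence of the roots\<close>

text \<open>The hypotheses determine the sign of the exponent. On the lower half of the branch
\<open>0 < gt h l < 1\<close>, so \<open>\<bar>l\<bar>\<close> is at most \<open>h * norm d = O(h powr (1 + q))\<close>. Since the branch extends far beyond \<open>- h ^ p\<close>, this forces \<open>1 + q < p\<close>. Consequently
every family of roots with the rate tends to \<open>1\<close>, which is what localises the uniqueness
argument.\<close>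

lemma rate_exponent_pos:
  assumes \<Theta>: "(\<lambda>(h, \<gamma>). norm (d h \<gamma>)) \<in> \<Theta>[at_right 0 \<times>\<^sub>F principal V](\<lambda>(h, \<gamma>). h powr q)"
  shows "0 < real p - 1 - q"
proof (rule ccontr)
  assume "\<not> 0 < real p - 1 - q"
  hence q: "real p \<le> 1 + q" by simp
  obtain C c' where "0 < C" and "0 < c'" and d: "\<forall>\<^sub>F h in at_right 0. \<forall>\<gamma>\<in>V. c' * h powr q \<le> \<bar>norm (d h \<gamma>)\<bar> \<and> \<bar>norm (d h \<gamma>)\<bar> \<le> C * h powr q"
    using bigtheta_prod_principalE[OF \<Theta>] .
  have "\<forall>\<^sub>F h::real in at_right 0. False"
    using d branch branch_reaches[of "2 * C"] eventually_at_right_less[of "0::real"]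
      eventually_at_right_real[of 0 1, simplified]
  proof eventually_elim
    case (elim h)
    define \<gamma> where "\<gamma> = gt h (- r h / 2)"
    have "0 < r h" using elim(2) by (simp add: implicit_branch_def)
    hence l: "\<bar>- r h / 2\<bar> < r h" by simp
    note step = branch_step[OF elim(2) l, folded \<gamma>_def]
    have "r h / 2 = (1 - \<gamma>) * (h * norm (d h \<gamma>))"
      using step(3) by (simp add: algebra_simps)
    also have "\<dots> \<le> 1 * (h * norm (d h \<gamma>))"
      using step(2) elim(4) by (intro mult_right_mono) auto
    also have "\<dots> \<le> h * (C * h powr q)"
      using elim(1,4) step(1) by auto
    also have "\<dots> = C * h powr (1 + q)"
      using elim(4) by (simp add: powr_add)
    also have "\<dots> \<le> C * h powr real p"
      using q elim(4,5) \<open>0 < C\<close> by (intro mult_left_mono powr_mono') auto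
    also have "\<dots> = C * h ^ p"
      using elim(4) by (simp add: powr_realpow)
    finally show ?case using elim(3) by simp
  qed
  thus False by simp
qed

lemma rate_tendsto_zero:
  assumes "(\<lambda>(h, \<gamma>). norm (d h \<gamma>)) \<in> \<Theta>[at_right 0 \<times>\<^sub>F principal V](\<lambda>(h, \<gamma>). h powr q)"
  shows "((\<lambda>h. h powr (real p - 1 - q)) \<longlongrightarrow> 0) (at_right 0)"
  using rate_exponent_pos[OF assms]
  by (intro tendsto_zero_powrI) (auto simp: eventually_at_right_less intro: eventually_mono[OF eventually_at_right_less[of "0::real"]])

text \<open>Solving \<open>l = (\<gamma> - 1) * h * norm d\<close> for \<open>\<gamma> - 1\<close>, with \<open>l\<close> of size \<open>h ^ p\<close> and \<open>norm d\<close> bounded below by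
a multiple of \<open>h powr q\<close>.\<close>

lemma branch_rate:
  assumes \<Theta>: "(\<lambda>(h, \<gamma>). norm (d h \<gamma>)) \<in> \<Theta>[at_right 0 \<times>\<^sub>F principal V](\<lambda>(h, \<gamma>). h powr q)"
    and "0 < a"
  obtains B where "0 < B" "\<forall>\<^sub>F h in at_right 0. \<forall>l. \<bar>l\<bar> \<le> a * h ^ p \<longrightarrow> \<bar>l\<bar> < r h \<longrightarrow>
     \<bar>gt h l - 1\<bar> \<le> B * h powr (real p - 1 - q)"
proof -
  obtain C c' where "0 < C" and "0 < c'" and d: "\<forall>\<^sub>F h in at_right 0. \<forall>\<gamma>\<in>V. c' * h powr q \<le> \<bar>norm (d h \<gamma>)\<bar> \<and> \<bar>norm (d h \<gamma>)\<bar> \<le> C * h powr q"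
    using bigtheta_prod_principalE[OF \<Theta>] .
  have "\<forall>\<^sub>F h in at_right 0. \<forall>l. \<bar>l\<bar> \<le> a * h ^ p \<longrightarrow> \<bar>l\<bar> < r h \<longrightarrow>
     \<bar>gt h l - 1\<bar> \<le> a / c' * h powr (real p - 1 - q)"
    using d branch eventually_at_right_less[of "0::real"]
  proof eventually_elim
    case (elim h)
    show ?case
    proof (intro allI impI)
      fix l assume l: "\<bar>l\<bar> \<le> a * h ^ p" "\<bar>l\<bar> < r h"
      note step = branch_step[OF elim(2) l(2)]
      have pos: "0 < h * h powr q" using elim(3) by simp
      have "\<bar>gt h l - 1\<bar> * (h * (c' * h powr q)) \<le> \<bar>gt h l - 1\<bar> * (h * norm (d h (gt h l)))"
        using elim(1,3) step(1) by (intro mult_left_mono) auto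
      also have "\<dots> = \<bar>(gt h l - 1) * h * norm (d h (gt h l))\<bar>"
        using elim(3) by (simp add: abs_mult)
      also have "\<dots> \<le> a * h ^ p" using l(1) unfolding step(3) .
      also have "\<dots> = a * (h * h powr q * h powr (real p - 1 - q))"
        using power_eq_powr_split[OF elim(3)] by simp
      finally have "(\<bar>gt h l - 1\<bar> * c') * (h * h powr q) \<le> (a * h powr (real p - 1 - q)) * (h * h powr q)"
        by (simp only: ac_simps)
      hence "\<bar>gt h l - 1\<bar> * c' \<le> a * h powr (real p - 1 - q)"
        using pos by (simp only: mult_le_cancel_right_pos)
      thus "\<bar>gt h l - 1\<bar> \<le> a / c' * h powr (real p - 1 - q)"
        using \<open>0 < c'\<close> by (simp add: field_simps)
    qed
  qed
  with \<open>0 < a\<close> \<open>0 < c'\<close> that[of "a / c'"] show ?thesis by simp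
qed

lemma root_with_rate_exists:
  assumes \<Theta>: "(\<lambda>(h, \<gamma>). norm (d h \<gamma>)) \<in> \<Theta>[at_right 0 \<times>\<^sub>F principal V](\<lambda>(h, \<gamma>). h powr q)"
  shows "\<exists>\<gamma>. root_with_rate V \<eta> urel (\<eta> un) (real p - 1 - q) \<gamma>"
proof -
  obtain a where "0 < a" and roots: "\<forall>\<^sub>F h in at_right 0.
      \<exists>l. \<bar>l\<bar> \<le> a * h ^ p \<and> \<bar>l\<bar> < r h \<and> positive_root V \<eta> (urel h) (\<eta> un) (gt h l)"
    using roots_on_branch .
  obtain B where "0 < B" and B: "\<forall>\<^sub>F h in at_right 0. \<forall>l. \<bar>l\<bar> \<le> a * h ^ p \<longrightarrow> \<bar>l\<bar> < r h \<longrightarrow>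
     \<bar>gt h l - 1\<bar> \<le> B * h powr (real p - 1 - q)"
    using branch_rate[OF \<Theta> \<open>0 < a\<close>] .
  have "\<forall>\<^sub>F h in at_right 0. \<exists>\<gamma>. positive_root V \<eta> (urel h) (\<eta> un) \<gamma> \<and>
          \<bar>\<gamma> - 1\<bar> \<le> B * h powr (real p - 1 - q)"
    using roots B by eventually_elim blast
  then obtain \<gamma> where \<gamma>: "\<forall>\<^sub>F h in at_right 0. positive_root V \<eta> (urel h) (\<eta> un) (\<gamma> h) \<and>
          \<bar>\<gamma> h - 1\<bar> \<le> B * h powr (real p - 1 - q)"
    unfolding eventually_ex by blast
  have "(\<lambda>h. \<gamma> h - 1) \<in> O[at_right 0](\<lambda>h. h powr (real p - 1 - q))"
    by (rule bigoI[where c = B]) (use \<gamma> in \<open>auto elim: eventually_mono\<close>)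
  with \<gamma> show ?thesis
    unfolding root_with_rate_def by (auto elim: eventually_mono)
qed

section \<open>Uniqueness of roots with the rate\<close>

text \<open>The slope hypothesis only speaks of points on the branch, while a competing root is any
point of \<open>V\<close> near \<open>1\<close>. The Lipschitz condition transfers the lower bound from the branch point at \<open>l = h ^ p\<close>,
where the slope is close to \<open>ct * h\<close>, to every \<open>\<gamma>\<close> at distance \<open>O(h powr (p - 1 - q))\<close> from \<open>1\<close>.\<close>

lemma slope_near_one:
  assumes \<Theta>: "(\<lambda>(h, \<gamma>). norm (d h \<gamma>)) \<in> \<Theta>[at_right 0 \<times>\<^sub>F principal V](\<lambda>(h, \<gamma>). h powr q)"
    and lip: "lipschitz_bigo V slope_at (\<lambda>h. h)"
  shows "\<forall>\<^sub>F h in at_right 0. \<forall>\<gamma>\<in>V. \<bar>\<gamma> - 1\<bar> \<le> B * h powr (real p - 1 - q) \<longrightarrow>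
           \<bar>ct\<bar> / 2 * h \<le> \<bar>slope_at h \<gamma>\<bar>"
proof -
  obtain C where "0 \<le> C" and C: "\<forall>\<^sub>F h in at_right 0. \<forall>x\<in>V. \<forall>y\<in>V.
      dist (slope_at h x) (slope_at h y) \<le> C * \<bar>h\<bar> * dist x y"
    using lipschitz_bigoE[OF lip] .
  obtain B0 where "0 < B0" and B0: "\<forall>\<^sub>F h in at_right 0. \<forall>l. \<bar>l\<bar> \<le> 1 * h ^ p \<longrightarrow> \<bar>l\<bar> < r h \<longrightarrow>
     \<bar>gt h l - 1\<bar> \<le> B0 * h powr (real p - 1 - q)"
    using branch_rate[OF \<Theta> zero_less_one] .
  have sl: "\<forall>\<^sub>F h in at_right 0. \<bar>slope_at h (gt h (1 * h ^ p)) - ct * h\<bar> \<le> \<bar>ct\<bar> / 4 * h"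
    using c_lim(2) by (intro slope_along_branch) auto
  have "((\<lambda>h. C * (B + B0) * h powr (real p - 1 - q)) \<longlongrightarrow> 0) (at_right 0)"
    by (intro tendsto_mult_right_zero rate_tendsto_zero[OF \<Theta>])
  hence small: "\<forall>\<^sub>F h in at_right 0. C * (B + B0) * h powr (real p - 1 - q) < \<bar>ct\<bar> / 4"
    using c_lim(2) by (intro order_tendstoD(2)) auto
  show ?thesis
    using C B0 sl small branch branch_reaches_abs[of 1] eventually_at_right_less[of "0::real"]
  proof eventually_elim
    case (elim h)
    define \<gamma>0 where "\<gamma>0 = gt h (1 * h ^ p)"
    have \<gamma>0: "\<gamma>0 \<in> V" "\<bar>\<gamma>0 - 1\<bar> \<le> B0 * h powr (real p - 1 - q)"
      using branch_step(1)[OF elim(5,6)] elim(2,6,7) by (auto simp: \<gamma>0_def)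
    show ?case
    proof (intro ballI impI)
      fix \<gamma> assume \<gamma>: "\<gamma> \<in> V" "\<bar>\<gamma> - 1\<bar> \<le> B * h powr (real p - 1 - q)"
      have "\<bar>\<gamma> - \<gamma>0\<bar> \<le> (B + B0) * h powr (real p - 1 - q)"
        using \<gamma>(2) \<gamma>0(2) by (simp add: distrib_right)
      hence "C * h * \<bar>\<gamma> - \<gamma>0\<bar> \<le> C * h * ((B + B0) * h powr (real p - 1 - q))"
        using \<open>0 \<le> C\<close> elim(7) by (intro mult_left_mono) auto
      also have "\<dots> = (C * (B + B0) * h powr (real p - 1 - q)) * h" by simp
      also have "\<dots> \<le> \<bar>ct\<bar> / 4 * h" using elim(4,7) by (intro mult_right_mono) auto
      finally have "\<bar>slope_at h \<gamma> - slope_at h \<gamma>0\<bar> \<le> \<bar>ct\<bar> / 4 * h"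
        using elim(1)[rule_format, OF \<gamma>(1) \<gamma>0(1)] elim(7)
        unfolding dist_real_def by (simp only: abs_of_pos)
      moreover have "\<bar>ct * h\<bar> = \<bar>ct\<bar> * h" using elim(7) by (simp add: abs_mult)
      ultimately show "\<bar>ct\<bar> / 2 * h \<le> \<bar>slope_at h \<gamma>\<bar>"
        using elim(3) unfolding \<gamma>0_def by (simp add: abs_if split: if_splits)
    qed
  qed
qed

text \<open>Put \<open>\<tau> = h powr (p - 1 - q)\<close> and \<open>H = h powr q\<close>, and let the two roots be \<open>\<Delta>\<close> apart. The function
\<open>\<gamma> \<mapsto> \<eta> (urel h \<gamma>)\<close> need not be differentiable, so strict monotonicity is replaced by a difference
estimate. The signed lengths \<open>l = (\<gamma> - 1) * h * norm d\<close> of the two displacements differ by at least a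
multiple of \<open>h * H * \<Delta>\<close>, and with a slope of size at least \<open>\<bar>ct\<bar> / 2 * h\<close> the linear terms
of \<open>\<eta>\<close> differ by at least a multiple of \<open>h\<^sup>2 * H * \<Delta>\<close>. The variation of the slope and that of the
remainder contribute \<open>O(h ^ (p + 1) * \<Delta>) = O(\<tau> * h\<^sup>2 * H * \<Delta>)\<close>, and the quadratic error contributes
\<open>O(h ^ p * h * H * \<Delta>) = O(h ^ (p - 1) * h\<^sup>2 * H * \<Delta>)\<close>. Both are of smaller order, so equal values
of \<open>\<eta>\<close> force \<open>\<Delta> = 0\<close>.\<close>

lemma root_with_rate_unique:
  assumes \<Theta>: "(\<lambda>(h, \<gamma>). norm (d h \<gamma>)) \<in> \<Theta>[at_right 0 \<times>\<^sub>F principal V](\<lambda>(h, \<gamma>). h powr q)"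
    and lip_d: "lipschitz_bigo V d (\<lambda>h. h powr q)"
    and lip_e: "lipschitz_bigo V remainder (\<lambda>h. h ^ (p + 1))"
    and lip_s: "lipschitz_bigo V slope_at (\<lambda>h. h)"
    and \<gamma>1: "root_with_rate V \<eta> urel (\<eta> un) (real p - 1 - q) \<gamma>1"
    and \<gamma>2: "root_with_rate V \<eta> urel (\<eta> un) (real p - 1 - q) \<gamma>2"
  shows "\<forall>\<^sub>F h in at_right 0. \<gamma>1 h = \<gamma>2 h"
proof -
  define \<tau> where "\<tau> h = h powr (real p - 1 - q)" for h :: real
  note \<tau>_lim = rate_tendsto_zero[OF \<Theta>, folded \<tau>_def]
  from C2_functional_local_expansion[OF eta_C2, where ?x0.0 = un]
  obtain \<rho> L K where "0 < \<rho>" "0 \<le> L" "0 \<le> K"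
    and L: "\<And>a v. a \<in> ball un \<rho> \<Longrightarrow> \<bar>frechet_derivative \<eta> (at a) v\<bar> \<le> L * norm v"
    and K: "\<And>a x y. \<lbrakk>a \<in> ball un \<rho>; x \<in> ball un \<rho>; y \<in> ball un \<rho>\<rbrakk> \<Longrightarrow>
           \<bar>\<eta> x - \<eta> y - frechet_derivative \<eta> (at a) (x - y)\<bar>
             \<le> K * (norm (x - a) + norm (y - a)) * norm (x - y)"
    by blast
  obtain E where "0 < E"
    and E: "\<forall>\<^sub>F h in at_right 0. \<forall>\<gamma>\<in>V. norm (remainder h \<gamma>) \<le> E * h ^ (p + 1)"
    using remainder_bound .
  obtain C c' where "0 < C" "0 < c'" and d: "\<forall>\<^sub>F h in at_right 0. \<forall>\<gamma>\<in>V.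
      c' * h powr q \<le> \<bar>norm (d h \<gamma>)\<bar> \<and> \<bar>norm (d h \<gamma>)\<bar> \<le> C * h powr q"
    using bigtheta_prod_principalE[OF \<Theta>] .
  obtain Cd where "0 \<le> Cd" and Cd: "\<forall>\<^sub>F h in at_right 0. \<forall>x\<in>V. \<forall>y\<in>V.
      dist (d h x) (d h y) \<le> Cd * \<bar>h powr q\<bar> * dist x y"
    using lipschitz_bigoE[OF lip_d] .
  obtain Ce where "0 \<le> Ce" and Ce: "\<forall>\<^sub>F h in at_right 0. \<forall>x\<in>V. \<forall>y\<in>V.
      dist (remainder h x) (remainder h y) \<le> Ce * \<bar>h ^ (p + 1)\<bar> * dist x y"
    using lipschitz_bigoE[OF lip_e] .
  obtain Cs where "0 \<le> Cs" and Cs: "\<forall>\<^sub>F h in at_right 0. \<forall>x\<in>V. \<forall>y\<in>V.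
      dist (slope_at h x) (slope_at h y) \<le> Cs * \<bar>h\<bar> * dist x y"
    using lipschitz_bigoE[OF lip_s] .
  obtain B1 where "0 < B1" and B1: "\<forall>\<^sub>F h in at_right 0. \<bar>\<gamma>1 h - 1\<bar> \<le> B1 * h powr (real p - 1 - q)"
    using powr_rate_bound \<gamma>1 unfolding root_with_rate_def by blast
  obtain B2 where "0 < B2" and B2: "\<forall>\<^sub>F h in at_right 0. \<bar>\<gamma>2 h - 1\<bar> \<le> B2 * h powr (real p - 1 - q)"
    using powr_rate_bound \<gamma>2 unfolding root_with_rate_def by blast
  have root1: "\<forall>\<^sub>F h in at_right 0. positive_root V \<eta> (urel h) (\<eta> un) (\<gamma>1 h)"
    and root2: "\<forall>\<^sub>F h in at_right 0. positive_root V \<eta> (urel h) (\<eta> un) (\<gamma>2 h)"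
    using \<gamma>1 \<gamma>2 unfolding root_with_rate_def by auto
  define B where "B = max B1 B2"
  have "0 < B" using \<open>0 < B1\<close> by (simp add: B_def)
  have B1': "\<forall>\<^sub>F h in at_right 0. \<bar>\<gamma>1 h - 1\<bar> \<le> B * \<tau> h"
    using B1 by eventually_elim
      (erule order_trans, auto simp: B_def \<tau>_def intro: mult_right_mono)
  have B2': "\<forall>\<^sub>F h in at_right 0. \<bar>\<gamma>2 h - 1\<bar> \<le> B * \<tau> h"
    using B2 by eventually_elim
      (erule order_trans, auto simp: B_def \<tau>_def intro: mult_right_mono)
  \<comment> \<open>\<open>Y * h ^ p\<close> will bound the displacements from \<open>A h\<close>, and \<open>Z * h * H * \<Delta>\<close> their difference.\<close>
  define Y where "Y = B * C + E"
  define Z where "Z = C + c' + Ce"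
  have "0 < Y" "0 < Z" using \<open>0 < B\<close> \<open>0 < C\<close> \<open>0 < E\<close> \<open>0 < c'\<close> \<open>0 \<le> Ce\<close> by (auto simp: Y_def Z_def add_pos_nonneg)
  have "((\<lambda>h. B * Cd * \<tau> h) \<longlongrightarrow> 0) (at_right 0)"
    by (intro tendsto_mult_right_zero \<tau>_lim)
  hence small1: "\<forall>\<^sub>F h in at_right 0. B * Cd * \<tau> h < c' / 2"
    using \<open>0 < c'\<close> by (intro order_tendstoD(2)) auto
  have small2: "\<forall>\<^sub>F h in at_right 0. \<tau> h < 1"
    using \<tau>_lim by (intro order_tendstoD(2)) auto
  have "((\<lambda>h. (B * C * Cs + L * Ce) * \<tau> h + 2 * K * Y * Z * h ^ (p - 1)) \<longlongrightarrow> 0) (at_right 0)"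
    using p_ge_2 by (intro tendsto_add_zero tendsto_mult_right_zero \<tau>_lim power_tendsto_0_at_right) simp
  hence small3: "\<forall>\<^sub>F h in at_right 0. (B * C * Cs + L * Ce) * \<tau> h + 2 * K * Y * Z * h ^ (p - 1) < c' * \<bar>ct\<bar> / 4"
    using \<open>0 < c'\<close> c_lim(2) by (intro order_tendstoD(2)) auto
  have "((\<lambda>h. Y * h ^ p) \<longlongrightarrow> 0) (at_right 0)"
    using p_ge_2 by (intro tendsto_mult_right_zero power_tendsto_0_at_right) simp
  hence step_small: "\<forall>\<^sub>F h in at_right 0. Y * h ^ p < \<rho> / 2"
    using \<open>0 < \<rho>\<close> by (intro order_tendstoD(2)) auto
  have base_near: "\<forall>\<^sub>F h in at_right 0. dist (A h) un < \<rho> / 2"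
    using \<open>0 < \<rho>\<close> by (intro tendstoD[OF base_tendsto]) simp
  show ?thesis
    using E d Cd Ce Cs B1' B2' root1 root2 slope_near_one[OF \<Theta> lip_s, of B, folded \<tau>_def]
      small1 small2 small3 step_small base_near
      eventually_at_right_less[of "0::real"] eventually_at_right_real[of 0 1, simplified]
  proof eventually_elim
    case (elim h)
    let ?\<gamma>1 = "\<gamma>1 h" and ?\<gamma>2 = "\<gamma>2 h"
    define \<Delta> where "\<Delta> = \<bar>?\<gamma>1 - ?\<gamma>2\<bar>"
    define H where "H = h powr q"
    define d1 d2 where "d1 = d h ?\<gamma>1" and "d2 = d h ?\<gamma>2"
    define e1 e2 where "e1 = remainder h ?\<gamma>1" and "e2 = remainder h ?\<gamma>2"
    define s1 s2 where "s1 = slope_at h ?\<gamma>1" and "s2 = slope_at h ?\<gamma>2"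
    define l1 l2 where "l1 = (?\<gamma>1 - 1) * h * norm d1" and "l2 = (?\<gamma>2 - 1) * h * norm d2"
    define y1 y2 where "y1 = urel h ?\<gamma>1 - A h" and "y2 = urel h ?\<gamma>2 - A h"
    have h: "0 < h" "h < 1" and "0 < H" "0 \<le> \<Delta>" "0 \<le> \<tau> h"
      using elim(16,17) by (auto simp: H_def \<Delta>_def \<tau>_def)
    have hp: "h ^ p = h * H * \<tau> h"
      using power_eq_powr_split[OF h(1)] by (simp add: H_def \<tau>_def)
    have hpp: "h ^ p = h * h ^ (p - 1)" using p_ge_2 by (cases p) auto
    have V: "?\<gamma>1 \<in> V" "?\<gamma>2 \<in> V" and eq: "\<eta> (urel h ?\<gamma>1) = \<eta> (urel h ?\<gamma>2)"
      using elim(8,9) by (auto simp: positive_root_def)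
    have d: "c' * H \<le> norm d1" "norm d1 \<le> C * H" "norm d2 \<le> C * H"
      using elim(2) V by (auto simp: d1_def d2_def H_def)
    have dd: "norm (d1 - d2) \<le> Cd * H * \<Delta>"
      using elim(3) V by (auto simp: d1_def d2_def H_def \<Delta>_def dist_norm)
    have e: "norm e1 \<le> E * h ^ (p + 1)" "norm e2 \<le> E * h ^ (p + 1)"
      using elim(1) V by (auto simp: e1_def e2_def)
    have ee: "norm (e1 - e2) \<le> Ce * h ^ (p + 1) * \<Delta>"
      using elim(4) V h(1) unfolding e1_def e2_def \<Delta>_def dist_norm by auto
    have ss: "\<bar>s1 - s2\<bar> \<le> Cs * h * \<Delta>"
      using elim(5) V h(1) by (auto simp: s1_def s2_def \<Delta>_def dist_real_def)
    have s1: "\<bar>ct\<bar> / 2 * h \<le> \<bar>s1\<bar>"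
      using elim(10) V(1) elim(6) by (simp add: s1_def)
    have l_bound: "\<bar>(\<gamma> - 1) * h * norm v\<bar> \<le> B * C * h ^ p"
      if "\<bar>\<gamma> - 1\<bar> \<le> B * \<tau> h" "norm v \<le> C * H" for \<gamma> v
    proof -
      have "\<bar>(\<gamma> - 1) * h * norm v\<bar> \<le> B * \<tau> h * h * (C * H)"
        unfolding abs_mult using that h(1) \<open>0 \<le> \<tau> h\<close> \<open>0 < B\<close> by (intro mult_mono) auto
      thus ?thesis by (simp add: hp ac_simps)
    qed
    have l: "\<bar>l1\<bar> \<le> B * C * h ^ p" "\<bar>l2\<bar> \<le> B * C * h ^ p"
      unfolding l1_def l2_def using elim(6,7) d by (intro l_bound; simp)+
    have y_eq: "y1 = ((?\<gamma>1 - 1) * h) *\<^sub>R d1 + e1" "y2 = ((?\<gamma>2 - 1) * h) *\<^sub>R d2 + e2"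
      by (simp_all add: y1_def y2_def d1_def d2_def e1_def e2_def)
    have "E * h ^ (p + 1) \<le> E * h ^ p"
      using h \<open>0 < E\<close> by (intro mult_left_mono power_decreasing) auto
    hence y: "norm y1 \<le> Y * h ^ p" "norm y2 \<le> Y * h ^ p"
      using l e h(1) norm_triangle_ineq[of "((?\<gamma>1 - 1) * h) *\<^sub>R d1" e1]
        norm_triangle_ineq[of "((?\<gamma>2 - 1) * h) *\<^sub>R d2" e2]
      by (auto simp: y_eq l1_def l2_def abs_mult Y_def distrib_right)
    \<comment> \<open>The direction changes so slowly in \<open>\<gamma>\<close> that it cannot compensate the change of \<open>\<gamma>\<close> in \<open>l\<close>.\<close>
    have drift: "h * \<bar>?\<gamma>2 - 1\<bar> * norm (d1 - d2) \<le> c' / 2 * (h * H * \<Delta>)"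
    proof -
      have "h * \<bar>?\<gamma>2 - 1\<bar> * norm (d1 - d2) \<le> h * (B * \<tau> h) * (Cd * H * \<Delta>)"
        using h(1) elim(7) dd \<open>0 < B\<close> \<open>0 \<le> \<tau> h\<close> by (intro mult_mono) auto
      also have "\<dots> = (B * Cd * \<tau> h) * (h * H * \<Delta>)" by simp
      also have "\<dots> \<le> c' / 2 * (h * H * \<Delta>)"
        using elim(11) h(1) \<open>0 < H\<close> \<open>0 \<le> \<Delta>\<close> by (intro mult_right_mono) auto
      finally show ?thesis .
    qed
    have yy: "norm (y1 - y2) \<le> Z * (h * H * \<Delta>)"
    proof -
      have "y1 - y2 = ((?\<gamma>1 - ?\<gamma>2) * h) *\<^sub>R d1 + (h * (?\<gamma>2 - 1)) *\<^sub>R (d1 - d2) + (e1 - e2)"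
        by (simp add: y_eq algebra_simps)
      hence "norm (y1 - y2) \<le> norm (((?\<gamma>1 - ?\<gamma>2) * h) *\<^sub>R d1) + norm ((h * (?\<gamma>2 - 1)) *\<^sub>R (d1 - d2)) + norm (e1 - e2)"
        by (metis norm_triangle_ineq norm_triangle_le add_right_mono order_trans)
      also have "\<dots> = \<Delta> * h * norm d1 + h * \<bar>?\<gamma>2 - 1\<bar> * norm (d1 - d2) + norm (e1 - e2)"
        using h(1) by (simp add: \<Delta>_def abs_mult)
      also have "\<dots> \<le> C * (h * H * \<Delta>) + c' * (h * H * \<Delta>) + Ce * (h * H * \<Delta>)"
      proof (intro add_mono)
        have "\<Delta> * h * norm d1 \<le> \<Delta> * h * (C * H)"
          using d(2) h(1) \<open>0 \<le> \<Delta>\<close> by (intro mult_left_mono) auto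
        thus "\<Delta> * h * norm d1 \<le> C * (h * H * \<Delta>)" by (simp only: ac_simps)
        have "0 \<le> c' * (h * H * \<Delta>)" using \<open>0 < c'\<close> h(1) \<open>0 < H\<close> \<open>0 \<le> \<Delta>\<close> by simp
        with drift show "h * \<bar>?\<gamma>2 - 1\<bar> * norm (d1 - d2) \<le> c' * (h * H * \<Delta>)" by simp
        have "h * \<tau> h \<le> 1 * 1" using h elim(12) \<open>0 \<le> \<tau> h\<close> by (intro mult_mono) auto
        hence "(h * \<tau> h) * (Ce * (h * H * \<Delta>)) \<le> 1 * (Ce * (h * H * \<Delta>))"
          using h(1) \<open>0 < H\<close> \<open>0 \<le> \<Delta>\<close> \<open>0 \<le> Ce\<close> by (intro mult_right_mono) auto
        with ee show "norm (e1 - e2) \<le> Ce * (h * H * \<Delta>)"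
          by (simp add: hp ac_simps)
      qed
      finally show ?thesis by (simp add: Z_def distrib_right)
    qed
    have A: "A h \<in> ball un \<rho>" using elim(15) \<open>0 < \<rho>\<close> by (simp add: dist_commute)
    have near: "w \<in> ball un \<rho>" if "norm (w - A h) \<le> Y * h ^ p" for w
      using dist_triangle[of w un "A h"] that elim(14,15) by (simp add: dist_norm norm_minus_commute)
    have "\<bar>\<eta> (urel h ?\<gamma>1) - \<eta> (urel h ?\<gamma>2) - frechet_derivative \<eta> (at (A h)) (y1 - y2)\<bar>
            \<le> K * (norm y1 + norm y2) * norm (y1 - y2)"
      using K[OF A near near, of "urel h ?\<gamma>1" "urel h ?\<gamma>2"] y by (simp add: y1_def y2_def)
    hence "\<bar>frechet_derivative \<eta> (at (A h)) (y1 - y2)\<bar> \<le> K * (norm y1 + norm y2) * norm (y1 - y2)"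
      by (simp add: eq)
    also have "\<dots> \<le> K * (2 * (Y * h ^ p)) * (Z * (h * H * \<Delta>))"
      using y yy \<open>0 \<le> K\<close> \<open>0 < Y\<close> h(1) by (intro mult_mono) auto
    finally have quad: "\<bar>frechet_derivative \<eta> (at (A h)) (y1 - y2)\<bar> \<le> K * (2 * (Y * h ^ p)) * (Z * (h * H * \<Delta>))" .
    \<comment> \<open>The slope is \<open>\<eta>'\<close> at the unit direction, so each displacement contributes length times slope.\<close>
    have lin: "frechet_derivative \<eta> (at (A h)) (y1 - y2)
        = (l1 * s1 - l2 * s2) + frechet_derivative \<eta> (at (A h)) (e1 - e2)"
      by (simp add: y_eq eta'_add eta'_diff frechet_derivative_eq_normalized_slope[OF eta_differentiable]
          l1_def l2_def s1_def s2_def d1_def d2_def)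
    have e_small: "\<bar>frechet_derivative \<eta> (at (A h)) (e1 - e2)\<bar> \<le> L * (Ce * h ^ (p + 1) * \<Delta>)"
      using L[OF A, of "e1 - e2"] mult_left_mono[OF ee \<open>0 \<le> L\<close>] by linarith
    have ll: "c' / 2 * (h * H * \<Delta>) \<le> \<bar>l1 - l2\<bar>"
    proof -
      have "l1 - l2 = (?\<gamma>1 - ?\<gamma>2) * (h * norm d1) + h * (?\<gamma>2 - 1) * (norm d1 - norm d2)"
        by (simp add: l1_def l2_def algebra_simps)
      moreover have "\<bar>(?\<gamma>1 - ?\<gamma>2) * (h * norm d1)\<bar> = \<Delta> * (h * norm d1)"
        using h(1) by (simp add: \<Delta>_def abs_mult)
      moreover have "\<Delta> * (h * (c' * H)) \<le> \<Delta> * (h * norm d1)"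
        using d(1) h(1) \<open>0 \<le> \<Delta>\<close> by (intro mult_left_mono) auto
      moreover have "\<bar>h * (?\<gamma>2 - 1) * (norm d1 - norm d2)\<bar> \<le> h * \<bar>?\<gamma>2 - 1\<bar> * norm (d1 - d2)"
        unfolding abs_mult using h(1) norm_triangle_ineq3[of d1 d2] by (intro mult_mono) auto
      moreover have "\<Delta> * (h * (c' * H)) = c' * (h * H * \<Delta>)" by simp
      ultimately show ?thesis using drift by linarith
    qed
    \<comment> \<open>\<open>l1 * s1 - l2 * s2 = (l1 - l2) * s1 + l2 * (s1 - s2)\<close>, where the first summand dominates.\<close>
    have "c' / 2 * (h * H * \<Delta>) * (\<bar>ct\<bar> / 2 * h) \<le> \<bar>l1 - l2\<bar> * \<bar>s1\<bar>"
      using ll s1 h(1) by (intro mult_mono) auto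
    also have "\<dots> = \<bar>(l1 * s1 - l2 * s2) - l2 * (s1 - s2)\<bar>"
      by (simp add: algebra_simps flip: abs_mult)
    also have "\<dots> \<le> \<bar>l1 * s1 - l2 * s2\<bar> + \<bar>l2 * (s1 - s2)\<bar>" by (rule abs_triangle_ineq4)
    also have "\<bar>l2 * (s1 - s2)\<bar> \<le> B * C * h ^ p * (Cs * h * \<Delta>)"
      unfolding abs_mult using l(2) ss \<open>0 < B\<close> \<open>0 < C\<close> h(1) by (intro mult_mono) auto
    also have "\<bar>l1 * s1 - l2 * s2\<bar> \<le> K * (2 * (Y * h ^ p)) * (Z * (h * H * \<Delta>)) + L * (Ce * h ^ (p + 1) * \<Delta>)"
      using quad e_small unfolding lin by linarith
    finally have "c' / 2 * (h * H * \<Delta>) * (\<bar>ct\<bar> / 2 * h)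
        \<le> K * (2 * (Y * h ^ p)) * (Z * (h * H * \<Delta>)) + L * (Ce * h ^ (p + 1) * \<Delta>) + B * C * h ^ p * (Cs * h * \<Delta>)"
      by simp
    also have "\<dots> = ((B * C * Cs + L * Ce) * \<tau> h + 2 * K * Y * Z * h ^ (p - 1)) * (h * h * H * \<Delta>)"
    proof -
      have "K * (2 * (Y * h ^ p)) * (Z * (h * H * \<Delta>)) = 2 * K * Y * Z * h ^ (p - 1) * (h * h * H * \<Delta>)"
        unfolding hpp by simp
      moreover have "L * (Ce * h ^ (p + 1) * \<Delta>) + B * C * h ^ p * (Cs * h * \<Delta>)
          = (B * C * Cs + L * Ce) * \<tau> h * (h * h * H * \<Delta>)"
        by (simp add: hp algebra_simps)
      ultimately show ?thesis by (simp only: distrib_right)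
    qed
    finally have "c' * \<bar>ct\<bar> / 4 * (h * h * H * \<Delta>)
        \<le> ((B * C * Cs + L * Ce) * \<tau> h + 2 * K * Y * Z * h ^ (p - 1)) * (h * h * H * \<Delta>)"
      by (simp add: ac_simps)
    hence "\<not> 0 < h * h * H * \<Delta>"
      using elim(13) by (metis mult_le_cancel_right_pos not_le)
    hence "\<Delta> = 0" using h(1) \<open>0 < H\<close> \<open>0 \<le> \<Delta>\<close> by (simp add: zero_less_mult_iff)
    thus ?case by (simp add: \<Delta>_def)
  qed
qed

end

section \<open>Existence, rate and uniqueness of the relaxation parameter\<close>

theorem theorem2:
  fixes f :: "real ^ 'n \<Rightarrow> real ^ 'n"
    and \<eta> :: "real ^ 'n \<Rightarrow> real"
    and \<Phi> :: "real \<Rightarrow> real ^ 'n \<Rightarrow> real ^ 'n"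
    and u :: "real \<Rightarrow> real ^ 'n"
    and tn :: real
    and un :: "real ^ 'n"
    and p :: nat
    and V :: "real set"
    and urel d :: "real \<Rightarrow> real \<Rightarrow> real ^ 'n"
    and gt :: "real \<Rightarrow> real \<Rightarrow> real"
    and r :: "real \<Rightarrow> real"
    and c :: "real ^ 'n \<Rightarrow> real \<Rightarrow> real"
    and ct :: "real ^ 'n \<Rightarrow> real"
  assumes eta_C2: "C2_functional \<eta>"
    and conservation: "conserves f \<eta>"
    and exact: "local_solution f tn un u"
    and order: "p \<ge> 2" "has_order_at f \<Phi> un p"
    and nbhd: "open V" "1 \<in> V"
    and update:
      "(\<lambda>(h, \<gamma>). norm (urel h \<gamma> - (\<Phi> h un + ((\<gamma> - 1) * h) *\<^sub>R d h \<gamma>)))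
         \<in> O[at_right 0 \<times>\<^sub>F principal V](\<lambda>(h, \<gamma>). h ^ (p + 1))"
    and update_cont: "\<forall>\<^sub>F h in at_right 0. continuous_on V (urel h)"
    and d_C1: "\<forall>\<^sub>F h in at_right 0. d h C1_differentiable_on V"
    and d_nonzero: "\<forall>\<^sub>F h in at_right 0. norm (d h 1) \<noteq> 0"
    and branch: "\<forall>\<^sub>F h in at_right 0. implicit_branch V (d h) h (r h) (gt h)"
    and branch_domain: "(\<lambda>h. h ^ p) \<in> o[at_right 0](r)"
    and slope:
      "(\<lambda>(h, \<mu>). normalized_slope \<eta> (\<Phi> h un) (d h (gt h (h * \<mu>))) - c un \<mu> * h)
         \<in> O[inf (at_right 0 \<times>\<^sub>F nhds 0) (principal {(h, \<mu>). \<bar>h * \<mu>\<bar> < r h})](\<lambda>(h, \<mu>). h ^ 2)"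
    and c_lim: "(c un \<longlongrightarrow> ct un) (at 0)" "ct un \<noteq> 0"
  shows "(\<forall>\<^sub>F h in at_right 0. \<exists>\<gamma>. positive_root V \<eta> (urel h) (\<eta> un) \<gamma>) \<and>
    (\<forall>q :: real.
       (\<lambda>(h, \<gamma>). norm (d h \<gamma>)) \<in> \<Theta>[at_right 0 \<times>\<^sub>F principal V](\<lambda>(h, \<gamma>). h powr q) \<longrightarrow>
       (\<exists>\<gamma>. root_with_rate V \<eta> urel (\<eta> un) (real p - 1 - q) \<gamma> \<and>
          (lipschitz_bigo V d (\<lambda>h. h powr q) \<and>
           lipschitz_bigo V (\<lambda>h \<gamma>. urel h \<gamma> - (\<Phi> h un + ((\<gamma> - 1) * h) *\<^sub>R d h \<gamma>)) (\<lambda>h. h ^ (p + 1)) \<and>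
           lipschitz_bigo V (\<lambda>h \<gamma>. normalized_slope \<eta> (\<Phi> h un) (d h \<gamma>)) (\<lambda>h. h) \<longrightarrow>
           (\<forall>\<gamma>'. root_with_rate V \<eta> urel (\<eta> un) (real p - 1 - q) \<gamma>' \<longrightarrow>
              (\<forall>\<^sub>F h in at_right 0. \<gamma>' h = \<gamma> h)))))"
proof (intro conjI allI impI)
  have "relaxed_step \<eta> (\<lambda>h. \<Phi> h un) un p V urel d gt r (c un) (ct un)"
    using eta_C2 one_step_tendsto[OF exact order(2)]
      one_step_conservation_defect[OF eta_C2 conservation exact order(2)]
      order(1) update update_cont branch branch_domain slope c_lim
    by (rule relaxed_step.intro)
  then interpret relaxed_step \<eta> "\<lambda>h. \<Phi> h un" un p V urel d gt r "c un" "ct un" .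
  obtain a where "0 < a" and roots: "\<forall>\<^sub>F h in at_right 0.
      \<exists>l. \<bar>l\<bar> \<le> a * h ^ p \<and> \<bar>l\<bar> < r h \<and> positive_root V \<eta> (urel h) (\<eta> un) (gt h l)"
    using roots_on_branch .
  show "\<forall>\<^sub>F h in at_right 0. \<exists>\<gamma>. positive_root V \<eta> (urel h) (\<eta> un) \<gamma>"
    using roots by (rule eventually_mono) blast
  fix q :: real
  assume \<Theta>: "(\<lambda>(h, \<gamma>). norm (d h \<gamma>)) \<in> \<Theta>[at_right 0 \<times>\<^sub>F principal V](\<lambda>(h, \<gamma>). h powr q)"
  obtain \<gamma> where \<gamma>: "root_with_rate V \<eta> urel (\<eta> un) (real p - 1 - q) \<gamma>"
    using root_with_rate_exists[OF \<Theta>] by blast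
  show "\<exists>\<gamma>. root_with_rate V \<eta> urel (\<eta> un) (real p - 1 - q) \<gamma> \<and>
          (lipschitz_bigo V d (\<lambda>h. h powr q) \<and>
           lipschitz_bigo V (\<lambda>h \<gamma>. urel h \<gamma> - (\<Phi> h un + ((\<gamma> - 1) * h) *\<^sub>R d h \<gamma>)) (\<lambda>h. h ^ (p + 1)) \<and>
           lipschitz_bigo V (\<lambda>h \<gamma>. normalized_slope \<eta> (\<Phi> h un) (d h \<gamma>)) (\<lambda>h. h) \<longrightarrow>
           (\<forall>\<gamma>'. root_with_rate V \<eta> urel (\<eta> un) (real p - 1 - q) \<gamma>' \<longrightarrow>
              (\<forall>\<^sub>F h in at_right 0. \<gamma>' h = \<gamma> h)))"
  proof (intro exI[of _ \<gamma>] conjI impI allI \<gamma>, elim conjE)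
    fix \<gamma>'
    assume lip: "lipschitz_bigo V d (\<lambda>h. h powr q)"
        "lipschitz_bigo V (\<lambda>h \<gamma>. urel h \<gamma> - (\<Phi> h un + ((\<gamma> - 1) * h) *\<^sub>R d h \<gamma>)) (\<lambda>h. h ^ (p + 1))"
        "lipschitz_bigo V (\<lambda>h \<gamma>. normalized_slope \<eta> (\<Phi> h un) (d h \<gamma>)) (\<lambda>h. h)"
      and \<gamma>': "root_with_rate V \<eta> urel (\<eta> un) (real p - 1 - q) \<gamma>'"
    show "\<forall>\<^sub>F h in at_right 0. \<gamma>' h = \<gamma> h"
      using root_with_rate_unique[OF \<Theta> lip \<gamma>' \<gamma>] .
  qed
qed

end
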